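(* Let $C=\{\bar m(t)\}$ $(0\le t\le T)$ be a smooth oriented regular curve in $\mathbf{S}^3$ or $\mathbb{E}^3$, and let $\gamma$ be the (lightlike) curve in $\mathcal{S}(1,3)\cong\Theta(1,3)\subset\mathbb{R}^{10}_4$ consisting of the osculating circles to $C$, $\gamma(t)$ being the osculating circle at $\bar m(t)$. Let $\rho$ be the conformal arc-length parameter of $C$. Then for every $t\in[0,T]$, $$\rho(t)-\rho(0)=\sqrt[4]{12}\,\lim_{\max|t_{j+1}-t_j|\to+0}\ \sum_{i}\sqrt{\|\gamma(t_{i+1})-\gamma(t_i)\|},$$ where $0=t_0<t_1<\cdots<t_k=t$ is a subdivision of the interval $[0,t]$.
   Context: $\mathbb{R}^5_1$ is $\mathbb{R}^5$ with coordinates $x_0,\dots,x_4$ and indefinite inner product $\langle \mathbf{x},\mathbf{y}\rangle=-x_0y_0+x_1y_1+\cdots+x_4y_4$. In any pseudo-Euclidean space $\|\mathbf{v}\|=\sqrt{|\langle \mathbf{v},\mathbf{v}\rangle|}$. The light cone is $\{\mathbf{v}:\langle \mathbf{v},\mathbf{v}\rangle=0\}$. $\mathbb{E}^3\cong\mathbb{R}^3$ is realized isometrically as $\{(1+\frac{x\cdot x}{4},\,-1+\frac{x\cdot x}{4},\,x): x\in\mathbb{R}^3\}$ in the light cone, and $\mathbf{S}^3$ as the intersection of the light cone with $\{x_0=1\}$; identifying points on the same lightlike line gives stereographic projection. A $3$-dimensional subspace of $\mathbb{R}^5_1$ is timelike if $\langle\,,\,\rangle$ restricted to it is non-degenerate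 and indefinite. $\mathcal{S}(1,3)$ is the set of oriented circles in $\mathbb{R}^3$ or $\mathbf{S}^3$ (lines in $\mathbb{R}^3$ count as circles). An oriented circle is the intersection of the model with a unique oriented timelike $3$-dimensional subspace $W$; the orientation of $W$ is such that three points of the circle taken in the cyclic order given by its orientation form a positive basis of $W$. $\bigwedge^3\mathbb{R}^5_1\cong\mathbb{R}^{10}$ carries $\langle \mathbf{x}_1\wedge \mathbf{x}_2\wedge \mathbf{x}_3,\mathbf{y}_1\wedge \mathbf{y}_2\wedge \mathbf{y}_3\rangle=-\det(\langle \mathbf{x}_i,\mathbf{y}_j\rangle)_{1\le i,j\le 3}$, of index $4$; this space is $\mathbb{R}^{10}_4$. $\mathcal{S}(1,3)$ is identified with a subset $\Theta(1,3)\subset\mathbb{R}^{10}_4$ by sending the circle given by $W$ to $\mathbf{x}_1\wedge \mathbf{x}_2\wedge \mathbf{x}_3/\|\mathbf{x}_1\wedge \mathbf{x}_2\wedge \mathbf{x}_3\|$ for a positive basis $(\mathbf{x}_1,\mathbf{x}_2,\mathbf{x}_3)$ of $W$. The osculating circle of $C$ at a point is the circle with second order contact with $C$ there, oriented like $C$ at that point. The conformal arc-length parameter $\rho$ of a curve in $\mathbb{R}^3$ with arc-length $s$, curvature $\kappa$ and torsion $\tau$ is defined by $d\rho=\sqrt[4]{\kappa'^2+\kappa^2\tau^2}\,ds$, with $'=d/ds$ (for a unit speed parametrization $m(s)$ one has $\kappa'^2+\kappa^2\tau^2=m'''\cdot m'''-(m''\cdot m'')^2$, which gives the meaning where $\kappa=0$).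 It is invariant under Möbius transformations, so it is defined for curves in $\mathbf{S}^3$ via stereographic projection. *)

theory Defs
  imports "HOL-Analysis.Analysis"
begin

section \<open>The Lorentz space and its third exterior power\<close>

text \<open>The coordinates $x_0,\dots,x_4$ are the components \<open>x $ 0, \<dots>, x $ 4\<close> of a vector of
  type \<open>real ^ 5\<close>; the index type \<open>5\<close> has exactly the elements \<open>0, 1, 2, 3, 4\<close>.\<close>

definition lsign :: "5 \<Rightarrow> real" where
  "lsign i = (if i = 0 then -1 else 1)"

definition lform :: "real ^ 5 \<Rightarrow> real ^ 5 \<Rightarrow> real" where
  "lform x y = (\<Sum>i\<in>UNIV. lsign i * x $ i * y $ i)"

definition light_cone :: "(real ^ 5) set" where
  "light_cone = {v. lform v v = 0}"

definition timelike3 :: "(real ^ 5) set \<Rightarrow> bool" where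
  "timelike3 W \<longleftrightarrow> subspace W \<and> dim W = 3
     \<and> (\<forall>v\<in>W. (\<forall>w\<in>W. lform v w = 0) \<longrightarrow> v = 0)
     \<and> (\<exists>v\<in>W. lform v v < 0) \<and> (\<exists>v\<in>W. lform v v > 0)"

text \<open>The third exterior power is realized as the 10-dimensional space of alternating tensors in
  \<open>real ^ 5 ^ 5 ^ 5\<close>. The component \<open>(i, j, k)\<close> of \<open>wedge3 x y z\<close> is the corresponding
  Pluecker coordinate.\<close>

type_synonym trivector = "real ^ 5 ^ 5 ^ 5"

definition wedge3 :: "real ^ 5 \<Rightarrow> real ^ 5 \<Rightarrow> real ^ 5 \<Rightarrow> trivector" where
  "wedge3 x y z = (\<chi> i j k. det (vector
     [vector [x $ i, x $ j, x $ k],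
      vector [y $ i, y $ j, y $ k],
      vector [z $ i, z $ j, z $ k]] :: real ^ 3 ^ 3))"

text \<open>The factor 1/6 accounts for the six orderings of each set of three distinct indices.\<close>

definition tform :: "trivector \<Rightarrow> trivector \<Rightarrow> real" where
  "tform a b = - (\<Sum>i\<in>UNIV. \<Sum>j\<in>UNIV. \<Sum>k\<in>UNIV.
     lsign i * lsign j * lsign k * a $ i $ j $ k * b $ i $ j $ k) / 6"

lemma tform_wedge3:
  "tform (wedge3 x1 x2 x3) (wedge3 y1 y2 y3) =
     - det (vector
         [vector [lform x1 y1, lform x1 y2, lform x1 y3],
          vector [lform x2 y1, lform x2 y2, lform x2 y3],
          vector [lform x3 y1, lform x3 y2, lform x3 y3]] :: real ^ 3 ^ 3)"
proof -
  define S :: "(5 \<Rightarrow> 5 \<Rightarrow> 5 \<Rightarrow> real) \<Rightarrow> real" where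
    "S f = (\<Sum>i\<in>UNIV. \<Sum>j\<in>UNIV. \<Sum>k\<in>UNIV. f i j k)" for f
  define w where "w i j k = lsign i * lsign j * lsign k" for i j k
  have add: "S (\<lambda>i j k. f i j k + g i j k) = S f + S g"
    and sub: "S (\<lambda>i j k. f i j k - g i j k) = S f - S g" for f g
    by (simp_all add: S_def sum.distrib sum_subtractf)
  have fac: "S (\<lambda>i j k. w i j k * ((p $ i * q $ j * r $ k) * (s $ i * t $ j * u $ k)))
      = lform p s * lform q t * lform r u" for p q r s t u
  proof -
    have "lform p s * lform q t * lform r u = S (\<lambda>i j k. (lsign i * p $ i * s $ i)
        * (lsign j * q $ j * t $ j) * (lsign k * r $ k * u $ k))"
      by (simp only: S_def lform_def sum_distrib_left[symmetric] sum_distrib_right[symmetric])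
    also have "\<dots> = S (\<lambda>i j k. w i j k * ((p $ i * q $ j * r $ k) * (s $ i * t $ j * u $ k)))"
      by (simp add: S_def w_def ac_simps)
    finally show ?thesis by simp
  qed
  define P where "P p q r = (\<lambda>i j k. p $ i * q $ j * r $ k)" for p q r :: "real ^ 5"
  have wedge: "wedge3 x y z $ i $ j $ k =
      P x y z i j k + P y z x i j k + P z x y i j k
      - P x z y i j k - P y x z i j k - P z y x i j k" for x y z i j k
    by (simp add: wedge3_def det_3 P_def algebra_simps)
  have fac': "S (\<lambda>i j k. w i j k * (P p q r i j k * P s t u i j k))
      = lform p s * lform q t * lform r u" for p q r s t u
    using fac by (simp add: P_def)
  have "tform (wedge3 x1 x2 x3) (wedge3 y1 y2 y3) =
      - S (\<lambda>i j k. w i j k * (wedge3 x1 x2 x3 $ i $ j $ k * wedge3 y1 y2 y3 $ i $ j $ k)) / 6"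
    by (simp add: tform_def S_def w_def mult.assoc)
  also have "\<dots> = - det (vector
         [vector [lform x1 y1, lform x1 y2, lform x1 y3],
          vector [lform x2 y1, lform x2 y2, lform x2 y3],
          vector [lform x3 y1, lform x3 y2, lform x3 y3]] :: real ^ 3 ^ 3)"
    unfolding wedge
    by (simp only: ring_distribs add sub fac') (simp add: det_3 field_simps)
  finally show ?thesis .
qed

definition tnorm :: "trivector \<Rightarrow> real" where
  "tnorm a = sqrt \<bar>tform a a\<bar>"


section \<open>The models of Euclidean 3-space and of the 3-sphere\<close>

definition flat_point :: "real ^ 3 \<Rightarrow> real ^ 5" where
  "flat_point x = (\<chi> i. if i = 0 then 1 + x \<bullet> x / 4 else if i = 1 then -1 + x \<bullet> x / 4
     else if i = 2 then x $ 1 else if i = 3 then x $ 2 else x $ 3)"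

definition E3 :: "(real ^ 5) set" where
  "E3 = range flat_point"

definition S3 :: "(real ^ 5) set" where
  "S3 = light_cone \<inter> {v. v $ 0 = 1}"


section \<open>Smooth curves\<close>

definition vd :: "real set \<Rightarrow> (real \<Rightarrow> 'a::real_normed_vector) \<Rightarrow> real \<Rightarrow> 'a" where
  "vd I f t = vector_derivative f (at t within I)"

text \<open>On a closed interval all derivatives are one-sided at the end points.\<close>

definition smooth_on :: "real set \<Rightarrow> (real \<Rightarrow> 'a::real_normed_vector) \<Rightarrow> bool" where
  "smooth_on I f \<longleftrightarrow> (\<forall>n. (vd I ^^ n) f differentiable_on I)"

definition regular_on :: "real set \<Rightarrow> (real \<Rightarrow> 'a::real_normed_vector) \<Rightarrow> bool" where
  "regular_on I f \<longleftrightarrow> (\<forall>t\<in>I. vd I f t \<noteq> 0)"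


section \<open>Oriented circles and osculating circles\<close>

text \<open>A circle of the model \<open>M\<close> is \<open>M \<inter> W\<close> for a timelike 3-dimensional subspace \<open>W\<close>. An
  orientation of it is given by a regular parametrization \<open>c\<close> of an open arc, traversed in the
  positive direction.\<close>

definition circle_arc :: "(real ^ 5) set \<Rightarrow> (real ^ 5) set \<Rightarrow> real set \<Rightarrow> (real \<Rightarrow> real ^ 5) \<Rightarrow> bool"
  where
  "circle_arc M W J c \<longleftrightarrow> timelike3 W \<and> (\<exists>a b. a < b \<and> J = {a<..<b})
     \<and> smooth_on J c \<and> regular_on J c \<and> inj_on c J \<and> c ` J \<subseteq> M \<inter> W"

text \<open>Three points of the arc with increasing parameters are in the cyclic order given by the
  orientation of the circle, hence form a positive basis of \<open>W\<close>. Two bases of \<open>W\<close> are equally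
  oriented iff their wedge products are positive multiples of each other.\<close>

definition positive_basis ::
  "(real ^ 5) set \<Rightarrow> real set \<Rightarrow> (real \<Rightarrow> real ^ 5) \<Rightarrow> real ^ 5 \<Rightarrow> real ^ 5 \<Rightarrow> real ^ 5 \<Rightarrow> bool" where
  "positive_basis W J c x y z \<longleftrightarrow> span {x, y, z} = W
     \<and> (\<forall>u\<in>J. \<forall>v\<in>J. \<forall>w\<in>J. u < v \<and> v < w \<longrightarrow>
          (\<exists>r>0. wedge3 x y z = r *\<^sub>R wedge3 (c u) (c v) (c w)))"

text \<open>\<open>\<theta>\<close> is the point of $\Theta(1,3)$ that is identified with the circle \<open>M \<inter> W\<close> oriented by
  its arc \<open>c\<close>.\<close>

definition oriented_circle ::
  "(real ^ 5) set \<Rightarrow> (real ^ 5) set \<Rightarrow> real set \<Rightarrow> (real \<Rightarrow> real ^ 5) \<Rightarrow> trivector \<Rightarrow> bool" where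
  "oriented_circle M W J c \<theta> \<longleftrightarrow> circle_arc M W J c
     \<and> (\<exists>x y z. positive_basis W J c x y z
          \<and> \<theta> = wedge3 x y z /\<^sub>R tnorm (wedge3 x y z))"

text \<open>Second order contact: the circle has a regular parametrization \<open>c\<close> with the same 2-jet as the
  curve. Equality of the first derivatives also gives the circle the orientation of the curve.\<close>

definition osculating_circle ::
  "(real ^ 5) set \<Rightarrow> real set \<Rightarrow> (real \<Rightarrow> real ^ 5) \<Rightarrow> real \<Rightarrow> trivector \<Rightarrow> bool" where
  "osculating_circle M I m t \<theta> \<longleftrightarrow> (\<exists>W J c. oriented_circle M W J c \<theta> \<and> t \<in> J
     \<and> c t = m t \<and> vd J c t = vd I m t \<and> vd J (vd J c) t = vd I (vd I m) t)"


section \<open>Conformal arc-length\<close>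

text \<open>\<open>darc I x f\<close> is the derivative $df/ds$ with respect to the arc-length $s$ of the curve \<open>x\<close>.\<close>

definition darc ::
  "real set \<Rightarrow> (real \<Rightarrow> real ^ 3) \<Rightarrow> (real \<Rightarrow> 'a::real_normed_vector) \<Rightarrow> real \<Rightarrow> 'a" where
  "darc I x f t = vd I f t /\<^sub>R norm (vd I x t)"

definition tangent :: "real set \<Rightarrow> (real \<Rightarrow> real ^ 3) \<Rightarrow> real \<Rightarrow> real ^ 3" where
  "tangent I x = darc I x x"

definition curvature :: "real set \<Rightarrow> (real \<Rightarrow> real ^ 3) \<Rightarrow> real \<Rightarrow> real" where
  "curvature I x t = norm (darc I x (tangent I x) t)"

definition unit_normal :: "real set \<Rightarrow> (real \<Rightarrow> real ^ 3) \<Rightarrow> real \<Rightarrow> real ^ 3" where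
  "unit_normal I x t = darc I x (tangent I x) t /\<^sub>R curvature I x t"

definition binormal :: "real set \<Rightarrow> (real \<Rightarrow> real ^ 3) \<Rightarrow> real \<Rightarrow> real ^ 3" where
  "binormal I x t = cross3 (tangent I x t) (unit_normal I x t)"

definition torsion :: "real set \<Rightarrow> (real \<Rightarrow> real ^ 3) \<Rightarrow> real \<Rightarrow> real" where
  "torsion I x t = darc I x (unit_normal I x) t \<bullet> binormal I x t"

text \<open>The quantity $\kappa'^2+\kappa^2\tau^2$. For the arc-length parametrization it equals
  $m'''\cdot m'''-(m''\cdot m'')^2$, which defines it at the points where $\kappa=0$.\<close>

definition conf_quantity :: "real set \<Rightarrow> (real \<Rightarrow> real ^ 3) \<Rightarrow> real \<Rightarrow> real" where
  "conf_quantity I x t =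
    (if curvature I x t \<noteq> 0
     then (darc I x (curvature I x) t)\<^sup>2 + (curvature I x t)\<^sup>2 * (torsion I x t)\<^sup>2
     else (let x2 = darc I x (tangent I x); x3 = darc I x x2
           in x3 t \<bullet> x3 t - (x2 t \<bullet> x2 t)\<^sup>2))"

text \<open>\<open>x\<close> is the curve in the ordinary 3-space that corresponds to \<open>m\<close>. A curve in \<open>S3\<close> is first
  rotated by \<open>A\<close> away from the pole of the stereographic projection, that is, the point of \<open>S3\<close> on
  the lightlike line that does not meet \<open>E3\<close>; the stereographic projection then identifies points
  on the same lightlike line.\<close>

definition euclidean_image :: "real set \<Rightarrow> (real \<Rightarrow> real ^ 5) \<Rightarrow> (real \<Rightarrow> real ^ 3) \<Rightarrow> bool" where
  "euclidean_image I m x \<longleftrightarrow>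
     (\<forall>t\<in>I. m t = flat_point (x t))
   \<or> (m ` I \<subseteq> S3 \<and> (\<exists>A. orthogonal_transformation A \<and> A (axis 0 1) = axis 0 1
        \<and> (\<forall>t\<in>I. \<exists>r. A (m t) = r *\<^sub>R flat_point (x t))))"

text \<open>The parameter \<open>\<rho>\<close> is determined up to an additive constant; the factor \<open>norm (vd I x t)\<close> is
  $ds/dt$.\<close>

definition conformal_arclength :: "real set \<Rightarrow> (real \<Rightarrow> real ^ 5) \<Rightarrow> (real \<Rightarrow> real) \<Rightarrow> bool" where
  "conformal_arclength I m \<rho> \<longleftrightarrow> (\<exists>x. euclidean_image I m x
     \<and> (\<forall>t\<in>I. (\<rho> has_real_derivative root 4 (conf_quantity I x t) * norm (vd I x t)) (at t within I)))"


section \<open>Subdivisions\<close>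

definition subdivisions :: "real \<Rightarrow> real \<Rightarrow> real list set" where
  "subdivisions a b = {ts. ts \<noteq> [] \<and> sorted_wrt (<) ts \<and> hd ts = a \<and> last ts = b}"

definition mesh_less :: "real list \<Rightarrow> real \<Rightarrow> bool" where
  "mesh_less ts \<delta> \<longleftrightarrow> (\<forall>i<length ts - 1. \<bar>ts ! Suc i - ts ! i\<bar> < \<delta>)"

definition mesh_to_0 :: "real \<Rightarrow> real \<Rightarrow> real list filter" where
  "mesh_to_0 a b = (INF \<delta>\<in>{0<..}. principal {ts \<in> subdivisions a b. mesh_less ts \<delta>})"

lemma eventually_mesh_to_0:
  "eventually P (mesh_to_0 a b) \<longleftrightarrow>
     (\<exists>\<delta>>0. \<forall>ts\<in>subdivisions a b. mesh_less ts \<delta> \<longrightarrow> P ts)"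
proof -
  have "eventually P (mesh_to_0 a b) \<longleftrightarrow>
      (\<exists>\<delta>\<in>{0<..}. eventually P (principal {ts \<in> subdivisions a b. mesh_less ts \<delta>}))"
    unfolding mesh_to_0_def
  proof (rule eventually_INF_base)
    fix d e :: real assume "d \<in> {0<..}" "e \<in> {0<..}"
    then show "\<exists>x\<in>{0<..}. principal {ts \<in> subdivisions a b. mesh_less ts x}
        \<le> inf (principal {ts \<in> subdivisions a b. mesh_less ts d})
              (principal {ts \<in> subdivisions a b. mesh_less ts e})"
      by (intro bexI[of _ "min d e"]) (auto simp: mesh_less_def)
  qed auto
  then show ?thesis
    by (auto simp: eventually_principal)
qed

lemma mesh_to_0_neq_bot:
  assumes "a \<le> b"
  shows "mesh_to_0 a b \<noteq> bot"
proof -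
  have "\<exists>ts\<in>subdivisions a b. mesh_less ts \<delta>" if "\<delta> > 0" for \<delta>
  proof (cases "a = b")
    case True
    then show ?thesis
      by (intro bexI[of _ "[a]"]) (auto simp: subdivisions_def mesh_less_def)
  next
    case False
    with assms have ab: "a < b" by simp
    obtain n where "(b - a) / \<delta> < real n"
      using reals_Archimedean2 by blast
    then have n: "(b - a) / \<delta> < real (Suc n)"
      by simp
    define g where "g i = a + real i * ((b - a) / real (Suc n))" for i
    define ts where "ts = map g [0..<Suc (Suc n)]"
    have step: "g (Suc i) - g i = (b - a) / real (Suc n)" for i
      by (simp add: g_def algebra_simps add_divide_distrib diff_divide_distrib)
    have "strict_mono g"
      using ab step by (intro strict_mono_Suc_iff[THEN iffD2]) (smt (verit) divide_pos_pos of_nat_0_less_iff zero_less_Suc)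
    then have "sorted_wrt (<) ts"
      unfolding ts_def sorted_wrt_map
      by (intro sorted_wrt_mono_rel[OF _ sorted_wrt_upt]) (auto simp: strict_mono_less)
    moreover have "hd ts = a"
      by (simp add: ts_def g_def upt_rec del: upt_Suc)
    moreover have "last ts = b"
      by (simp add: ts_def g_def)
    ultimately have "ts \<in> subdivisions a b"
      by (auto simp: subdivisions_def ts_def)
    moreover have "(b - a) / real (Suc n) < \<delta>"
      using n that by (simp add: field_simps)
    then have "mesh_less ts \<delta>"
      using ab step by (auto simp: mesh_less_def ts_def nth_append simp del: upt_Suc)
    ultimately show ?thesis by blast
  qed
  then show ?thesis
    unfolding trivial_limit_def eventually_mesh_to_0 by blast
qed

end

theory Submission
  imports Defs
begin

text \<open>
  Multiplying the lift \<open>m\<close> to the light cone by a positive function does not change the osculating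
  circles, so \<open>m\<close> may be replaced by the lift \<open>n\<close> with \<open>lform n' n' = 1\<close>; no reparametrization
  is needed. Then \<open>\<gamma> = n \<and> n' \<and> n''\<close> and \<open>\<gamma>' = n \<and> n' \<and> n'''\<close>, and differentiating the two
  normalisations \<open>lform n n = 0\<close> and \<open>lform n' n' = 1\<close> shows that \<open>\<gamma>'\<close> is lightlike and that
  \<open>tform \<gamma>'' \<gamma>'' = Q\<close> with \<open>Q = lform n''' n''' - (lform n'' n'')\<^sup>2\<close>. For a lightlike curve the terms
  of order less than 4 in \<open>tform (\<gamma> s - \<gamma> t) (\<gamma> s - \<gamma> t)\<close> vanish, and what remains is
  \<open>- Q t * (s - t) ^ 4 / 12\<close>, uniformly in \<open>t\<close>. Computing \<open>Q\<close> for the multiple of \<open>flat_point (x t)\<close>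
  gives \<open>conf_quantity * speed ^ 4\<close>, so each summand is the increment of \<open>\<rho>\<close> divided by
  \<open>root 4 12\<close>, up to an error that is uniformly small relative to the step.
\<close>


section \<open>Finitely often differentiable curves\<close>

text \<open>The derivative is existentially quantified, so the closure rules under sums, products,
  inverses and roots need no uniqueness of derivatives. Only the return to \<open>vd\<close> uses
  that every point of \<open>I\<close> is a limit point.\<close>

primrec C_diff :: "nat \<Rightarrow> real set \<Rightarrow> (real \<Rightarrow> 'a::real_normed_vector) \<Rightarrow> bool" where
  "C_diff 0 I f \<longleftrightarrow> continuous_on I f"
| "C_diff (Suc n) I f \<longleftrightarrow>
     (\<exists>f'. (\<forall>t\<in>I. (f has_vector_derivative f' t) (at t within I)) \<and> C_diff n I f')"

lemma C_diff_SucI: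
  assumes "\<And>t. t \<in> I \<Longrightarrow> (f has_vector_derivative f' t) (at t within I)" "C_diff n I f'"
  shows "C_diff (Suc n) I f"
  using assms by auto

lemma C_diff_SucE:
  assumes "C_diff (Suc n) I f"
  obtains f' where "\<And>t. t \<in> I \<Longrightarrow> (f has_vector_derivative f' t) (at t within I)" "C_diff n I f'"
  using assms by auto

lemma C_diff_continuous_on: "C_diff n I f \<Longrightarrow> continuous_on I f"
  by (cases n) (auto intro: continuous_on_vector_derivative)

lemma C_diff_Suc_imp: "C_diff (Suc n) I f \<Longrightarrow> C_diff n I f"
proof (induction n arbitrary: f)
  case 0
  then show ?case using C_diff_continuous_on[of "Suc 0" I f] by simp
next
  case (Suc n)
  then obtain f' where
    "\<And>t. t \<in> I \<Longrightarrow> (f has_vector_derivative f' t) (at t within I)" "C_diff (Suc n) I f'"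
    unfolding C_diff.simps(2)[of "Suc n"] by auto
  then show ?case using Suc.IH by (intro C_diff_SucI[of _ _ f']) auto
qed

lemma C_diff_cong:
  assumes "\<And>t. t \<in> I \<Longrightarrow> f t = g t"
  shows "C_diff n I f \<longleftrightarrow> C_diff n I g"
proof (cases n)
  case 0
  then show ?thesis using assms by (simp cong: continuous_on_cong)
next
  case (Suc k)
  have "(f has_vector_derivative D) (at t within I) \<longleftrightarrow> (g has_vector_derivative D) (at t within I)"
    if "t \<in> I" for t D
    using that assms by (metis has_vector_derivative_transform)
  then show ?thesis by (simp add: Suc)
qed

lemma C_diff_const: "C_diff n I (\<lambda>t. c)"
proof (induction n arbitrary: c)
  case (Suc n)
  show ?case by (rule C_diff_SucI[of _ _ "\<lambda>t. 0"]) (simp_all add: Suc.IH)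
qed simp

lemma C_diff_add: "C_diff n I f \<Longrightarrow> C_diff n I g \<Longrightarrow> C_diff n I (\<lambda>t. f t + g t)"
proof (induction n arbitrary: f g)
  case 0
  then show ?case by (simp add: continuous_on_add)
next
  case (Suc n)
  obtain f' where "\<And>t. t \<in> I \<Longrightarrow> (f has_vector_derivative f' t) (at t within I)" "C_diff n I f'"
    using Suc.prems(1) by (rule C_diff_SucE) blast
  moreover obtain g' where "\<And>t. t \<in> I \<Longrightarrow> (g has_vector_derivative g' t) (at t within I)" "C_diff n I g'"
    using Suc.prems(2) by (rule C_diff_SucE) blast
  ultimately show ?case
    by (intro C_diff_SucI[of _ _ "\<lambda>t. f' t + g' t"] Suc.IH has_vector_derivative_add)
qed

lemma C_diff_bounded_linear:
  assumes "bounded_linear F"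
  shows "C_diff n I f \<Longrightarrow> C_diff n I (\<lambda>t. F (f t))"
proof (induction n arbitrary: f)
  case 0
  then show ?case using assms by (simp add: bounded_linear.continuous_on)
next
  case (Suc n)
  obtain f' where
    f: "\<And>t. t \<in> I \<Longrightarrow> (f has_vector_derivative f' t) (at t within I)" "C_diff n I f'"
    using Suc.prems by (rule C_diff_SucE) blast
  then show ?case
    by (intro C_diff_SucI[of _ _ "\<lambda>t. F (f' t)"] Suc.IH bounded_linear.has_vector_derivative[OF assms])
qed

text \<open>In each Leibniz term one factor stays underived; \<open>C_diff_Suc_imp\<close> lowers
  its order so that the induction hypothesis fits both factors.\<close>

lemma C_diff_bounded_bilinear:
  assumes "bounded_bilinear B"
  shows "C_diff n I f \<Longrightarrow> C_diff n I g \<Longrightarrow> C_diff n I (\<lambda>t. B (f t) (g t))"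
proof (induction n arbitrary: f g)
  case 0
  then show ?case using assms by (simp add: bounded_bilinear.continuous_on)
next
  case (Suc n)
  obtain f' where
    f: "\<And>t. t \<in> I \<Longrightarrow> (f has_vector_derivative f' t) (at t within I)" "C_diff n I f'"
    using Suc.prems(1) by (rule C_diff_SucE) blast
  obtain g' where
    g: "\<And>t. t \<in> I \<Longrightarrow> (g has_vector_derivative g' t) (at t within I)" "C_diff n I g'"
    using Suc.prems(2) by (rule C_diff_SucE) blast
  show ?case
  proof (rule C_diff_SucI)
    show "((\<lambda>t. B (f t) (g t)) has_vector_derivative B (f t) (g' t) + B (f' t) (g t)) (at t within I)"
      if "t \<in> I" for t
      using that f g assms by (intro bounded_bilinear.has_vector_derivative)
    show "C_diff n I (\<lambda>t. B (f t) (g' t) + B (f' t) (g t))"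
      by (intro C_diff_add Suc.IH f g C_diff_Suc_imp[OF Suc.prems(1)] C_diff_Suc_imp[OF Suc.prems(2)])
  qed
qed

lemmas C_diff_scaleR = C_diff_bounded_bilinear[OF bounded_bilinear_scaleR]
  and C_diff_mult = C_diff_bounded_bilinear[OF bounded_bilinear_mult]
  and C_diff_inner = C_diff_bounded_bilinear[OF bounded_bilinear_inner]

lemma C_diff_inverse:
  fixes f :: "real \<Rightarrow> real"
  assumes "\<And>t. t \<in> I \<Longrightarrow> f t \<noteq> 0"
  shows "C_diff n I f \<Longrightarrow> C_diff n I (\<lambda>t. inverse (f t))"
proof (induction n)
  case 0
  then show ?case using assms by (simp add: continuous_on_inverse)
next
  case (Suc n)
  obtain f' where
    f: "\<And>t. t \<in> I \<Longrightarrow> (f has_vector_derivative f' t) (at t within I)" "C_diff n I f'"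
    using Suc.prems by (rule C_diff_SucE) blast
  have inv: "C_diff n I (\<lambda>t. inverse (f t))"
    using Suc C_diff_Suc_imp by blast
  show ?case
  proof (rule C_diff_SucI)
    \<comment> \<open>Written as a product of \<open>inverse (f t)\<close> and \<open>f' t\<close>,
      the derivative falls under \<open>C_diff_mult\<close>, with \<open>inv\<close> as the claim at
      the lower order.\<close>
    show "((\<lambda>t. inverse (f t)) has_vector_derivative - 1 * (inverse (f t) * (f' t * inverse (f t))))
        (at t within I)" if "t \<in> I" for t
      using f(1)[OF that] assms[OF that]
      by (auto simp: has_real_derivative_iff_has_vector_derivative[symmetric] power2_eq_square
          intro!: derivative_eq_intros)
    show "C_diff n I (\<lambda>t. - 1 * (inverse (f t) * (f' t * inverse (f t))))"
      by (intro C_diff_mult C_diff_const inv f)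
  qed
qed

lemma C_diff_sqrt:
  fixes f :: "real \<Rightarrow> real"
  assumes "\<And>t. t \<in> I \<Longrightarrow> f t > 0"
  shows "C_diff n I f \<Longrightarrow> C_diff n I (\<lambda>t. sqrt (f t))"
proof (induction n)
  case 0
  then show ?case by (simp add: continuous_on_real_sqrt)
next
  case (Suc n)
  obtain f' where
    f: "\<And>t. t \<in> I \<Longrightarrow> (f has_vector_derivative f' t) (at t within I)" "C_diff n I f'"
    using Suc.prems by (rule C_diff_SucE) blast
  have sq: "C_diff n I (\<lambda>t. sqrt (f t))"
    using Suc C_diff_Suc_imp by blast
  show ?case
  proof (rule C_diff_SucI)
    show "((\<lambda>t. sqrt (f t)) has_vector_derivative inverse 2 * (f' t * inverse (sqrt (f t))))
        (at t within I)" if "t \<in> I" for t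
      using f(1)[OF that] assms[OF that]
      by (auto simp: has_real_derivative_iff_has_vector_derivative[symmetric] field_simps
          intro!: derivative_eq_intros)
    show "C_diff n I (\<lambda>t. inverse 2 * (f' t * inverse (sqrt (f t))))"
      using assms by (intro C_diff_mult C_diff_const C_diff_inverse sq f) fastforce
  qed
qed

section \<open>The chosen derivative \<open>vd\<close> and mean value estimates\<close>

lemma vd_eqI:
  assumes "(f has_vector_derivative D) (at t within I)" "at t within I \<noteq> bot"
  shows "vd I f t = D"
  unfolding vd_def using assms vector_derivative_within by blast

lemma has_vector_derivative_vd:
  assumes "C_diff (Suc n) I f" "t \<in> I"
  shows "(f has_vector_derivative vd I f t) (at t within I)"
proof -
  obtain f' where "(f has_vector_derivative f' t) (at t within I)"
    using assms by (auto elim: C_diff_SucE)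
  then show ?thesis
    unfolding vd_def by (metis differentiableI_vector vector_derivative_works)
qed

lemma C_diff_vd:
  assumes "C_diff (Suc n) I f" "\<And>t. t \<in> I \<Longrightarrow> at t within I \<noteq> bot"
  shows "C_diff n I (vd I f)"
proof -
  obtain f' where
    f: "\<And>t. t \<in> I \<Longrightarrow> (f has_vector_derivative f' t) (at t within I)" "C_diff n I f'"
    using assms(1) by (rule C_diff_SucE) blast
  have "vd I f t = f' t" if "t \<in> I" for t
    using f(1) assms(2) that by (intro vd_eqI)
  then show ?thesis using f(2) C_diff_cong by metis
qed

text \<open>Smoothness passes from \<open>f\<close> to \<open>vd I f\<close>, whose iterated
  derivatives are later iterates for \<open>f\<close>; so the induction can take
  \<open>vd I f\<close> as the derivative.\<close>

lemma smooth_on_imp_C_diff: "smooth_on I f \<Longrightarrow> C_diff n I f"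
proof (induction n arbitrary: f)
  case 0
  then have "((vd I ^^ 0) f) differentiable_on I" unfolding smooth_on_def by blast
  then show ?case by (simp add: differentiable_imp_continuous_on)
next
  case (Suc n)
  have "((vd I ^^ 0) f) differentiable_on I" using Suc.prems unfolding smooth_on_def by blast
  then have d: "(f has_vector_derivative vd I f t) (at t within I)" if "t \<in> I" for t
    using that by (simp add: vd_def differentiable_on_def vector_derivative_works)
  have "((vd I ^^ k) (vd I f)) differentiable_on I" for k
    using Suc.prems unfolding smooth_on_def by (metis funpow_Suc_right comp_apply)
  then have "smooth_on I (vd I f)" by (simp add: smooth_on_def)
  then show ?case using d Suc.IH by auto
qed

lemma at_within_Icc_neq_bot:
  fixes a b t :: real
  assumes "a < b" "t \<in> {a..b}"
  shows "at t within {a..b} \<noteq> bot"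
  using assms by (simp add: trivial_limit_within islimpt_Icc)

lemma at_within_Ioo_neq_bot:
  fixes a b t :: real
  assumes "t \<in> {a<..<b}"
  shows "at t within {a<..<b} \<noteq> bot"
  unfolding at_within_open[OF assms open_greaterThanLessThan] by (rule at_neq_bot)

text \<open>By monotonicity the derivative is at most \<open>C * (s - t) ^ n\<close> on the whole
  interval. The factor \<open>1 / (n + 1)\<close> that integration would give is dropped, as only
  the order matters later.\<close>

lemma mean_value_power_bound:
  fixes f :: "real \<Rightarrow> 'a::real_normed_vector"
  assumes "t \<le> s" "0 \<le> C"
    and "\<And>u. u \<in> {t..s} \<Longrightarrow> (f has_vector_derivative f' u) (at u within {t..s})"
    and "\<And>u. u \<in> {t..s} \<Longrightarrow> norm (f' u) \<le> C * (u - t) ^ n"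
  shows "norm (f s - f t) \<le> C * (s - t) ^ Suc n"
proof -
  have "norm (f s - f t) \<le> C * (s - t) ^ n * norm (s - t)"
  proof (rule differentiable_bound[of "{t..s}" f "\<lambda>u h. h *\<^sub>R f' u"])
    fix u assume u: "u \<in> {t..s}"
    then show "(f has_derivative (\<lambda>h. h *\<^sub>R f' u)) (at u within {t..s})"
      using assms(3) by (simp add: has_vector_derivative_def)
    have "norm (f' u) \<le> C * (s - t) ^ n"
      using u assms(2) assms(4)[OF u] by (intro order_trans[OF assms(4)[OF u]] mult_left_mono power_mono) auto
    then show "onorm (\<lambda>h. h *\<^sub>R f' u) \<le> C * (s - t) ^ n"
      by (intro onorm_le) (simp add: mult.commute[of _ "\<bar>_\<bar>"] mult_left_mono)
  qed (use assms in auto)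
  then show ?thesis using assms(1) by (simp add: mult_ac)
qed


section \<open>Lorentz space and its third exterior power\<close>

lemma UNIV_5: "UNIV = {0, 1, 2, 3, 4 :: 5}"
proof -
  have "card {0, 1, 2, 3, 4 :: 5} = card (UNIV :: 5 set)" by simp
  then show ?thesis by (metis card_subset_eq finite subset_UNIV)
qed

lemma sum_5: "sum f (UNIV :: 5 set) = f 0 + f 1 + f 2 + f 3 + f 4"
  unfolding UNIV_5 by (simp add: add.assoc)

lemma lform_expand:
  "lform x y = - x$0 * y$0 + x$1 * y$1 + x$2 * y$2 + x$3 * y$3 + x$4 * y$4"
  by (simp add: lform_def sum_5 lsign_def)

lemma lform_inner: "lform x y = x \<bullet> y - 2 * (x$0 * y$0)"
  by (simp add: lform_expand inner_vec_def sum_5)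

lemma lform_commute: "lform x y = lform y x"
  by (simp add: lform_expand mult.commute)

lemma lform_add: "lform (x + y) z = lform x z + lform y z" "lform x (y + z) = lform x y + lform x z"
  by (simp_all add: lform_expand algebra_simps)

lemma lform_scaleR: "lform (c *\<^sub>R x) z = c * lform x z" "lform x (c *\<^sub>R z) = c * lform x z"
  by (simp_all add: lform_expand algebra_simps)

lemma bounded_bilinear_lform: "bounded_bilinear lform"
  unfolding bilinear_conv_bounded_bilinear[symmetric] bilinear_def
  by (auto intro!: linearI simp: lform_add lform_scaleR)

text \<open>The zeroth coordinate is the inner product with the fixed vector
  \<open>axis 0 1\<close>, and by \<open>lform_inner\<close> the Lorentz form depends only on this
  coordinate and the Euclidean inner product.\<close>

lemma lform_orthogonal_transformation:
  assumes "orthogonal_transformation A" "A (axis 0 1) = axis 0 1"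
  shows "lform (A x) (A y) = lform x y" "A x $ 0 = x $ 0"
proof -
  show *: "A x $ 0 = x $ 0" for x
  proof -
    have "A x $ 0 = A x \<bullet> A (axis 0 1)"
      unfolding assms(2) by (rule cart_eq_inner_axis)
    also have "\<dots> = x \<bullet> axis 0 1"
      using assms(1) by (simp add: orthogonal_transformation_def)
    finally show ?thesis
      by (simp add: cart_eq_inner_axis[symmetric])
  qed
  show "lform (A x) (A y) = lform x y"
    using assms(1) by (simp add: lform_inner * orthogonal_transformation_def)
qed

section \<open>The form on trivectors and the calculus of the wedge product\<close>

lemma tform_add: "tform (a + b) c = tform a c + tform b c" "tform a (b + c) = tform a b + tform a c"
  by (simp_all add: tform_def distrib_left distrib_right sum.distrib)

lemma tform_scaleR: "tform (r *\<^sub>R a) b = r * tform a b" "tform a (r *\<^sub>R b) = r * tform a b"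
  by (simp_all add: tform_def sum_distrib_left algebra_simps)

lemma tform_commute: "tform a b = tform b a"
  by (simp add: tform_def mult_ac)

lemma bounded_bilinear_tform: "bounded_bilinear tform"
  unfolding bilinear_conv_bounded_bilinear[symmetric] bilinear_def
  by (auto intro!: linearI simp: tform_add tform_scaleR)

text \<open>The trilinear \<open>wedge3\<close> is split into two bilinear maps by cofactor
  expansion, so that limits, continuity and derivatives follow from the rules for bounded bilinear
  maps.\<close>

definition wedge2 :: "real ^ 5 \<Rightarrow> real ^ 5 \<Rightarrow> real ^ 5 ^ 5" where
  "wedge2 y z = (\<chi> j k. y $ j * z $ k - y $ k * z $ j)"

definition wedge12 :: "real ^ 5 \<Rightarrow> real ^ 5 ^ 5 \<Rightarrow> trivector" where
  "wedge12 x P = (\<chi> i j k. x $ i * P $ j $ k + x $ j * P $ k $ i + x $ k * P $ i $ j)"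

lemma wedge3_conv: "wedge3 x y z = wedge12 x (wedge2 y z)"
  by (simp add: vec_eq_iff wedge3_def wedge12_def wedge2_def det_3 algebra_simps)

lemma bounded_bilinear_wedge2: "bounded_bilinear wedge2"
  unfolding bilinear_conv_bounded_bilinear[symmetric] bilinear_def
  by (auto intro!: linearI simp: wedge2_def vec_eq_iff algebra_simps)

lemma bounded_bilinear_wedge12: "bounded_bilinear wedge12"
  unfolding bilinear_conv_bounded_bilinear[symmetric] bilinear_def
  by (auto intro!: linearI simp: wedge12_def vec_eq_iff algebra_simps)

lemma wedge3_add:
  "wedge3 (x + x') y z = wedge3 x y z + wedge3 x' y z"
  "wedge3 x (y + y') z = wedge3 x y z + wedge3 x y' z"
  "wedge3 x y (z + z') = wedge3 x y z + wedge3 x y z'"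
  by (simp_all add: wedge3_def vec_eq_iff det_3 algebra_simps)

lemma wedge3_scaleR:
  "wedge3 (c *\<^sub>R x) y z = c *\<^sub>R wedge3 x y z"
  "wedge3 x (c *\<^sub>R y) z = c *\<^sub>R wedge3 x y z"
  "wedge3 x y (c *\<^sub>R z) = c *\<^sub>R wedge3 x y z"
  by (simp_all add: wedge3_def vec_eq_iff det_3 algebra_simps)

lemma wedge3_same: "wedge3 x x z = 0" "wedge3 x y x = 0" "wedge3 x y y = 0"
  by (simp_all add: wedge3_def vec_eq_iff det_3 algebra_simps)

lemma has_vector_derivative_wedge3:
  assumes "(x has_vector_derivative x') (at t within I)"
    and "(y has_vector_derivative y') (at t within I)"
    and "(z has_vector_derivative z') (at t within I)"
  shows "((\<lambda>t. wedge3 (x t) (y t) (z t)) has_vector_derivative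
    wedge3 x' (y t) (z t) + wedge3 (x t) y' (z t) + wedge3 (x t) (y t) z') (at t within I)"
proof -
  have "((\<lambda>t. wedge12 (x t) (wedge2 (y t) (z t))) has_vector_derivative
     wedge12 (x t) (wedge2 (y t) z' + wedge2 y' (z t)) + wedge12 x' (wedge2 (y t) (z t))) (at t within I)"
    by (intro bounded_bilinear.has_vector_derivative[OF bounded_bilinear_wedge12]
        bounded_bilinear.has_vector_derivative[OF bounded_bilinear_wedge2] assms)
  then show ?thesis
    by (simp add: wedge3_conv bounded_bilinear.add_right[OF bounded_bilinear_wedge12] ac_simps)
qed

lemma C_diff_wedge3:
  "C_diff n I x \<Longrightarrow> C_diff n I y \<Longrightarrow> C_diff n I z \<Longrightarrow> C_diff n I (\<lambda>t. wedge3 (x t) (y t) (z t))"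
  unfolding wedge3_conv
  by (intro C_diff_bounded_bilinear[OF bounded_bilinear_wedge12]
      C_diff_bounded_bilinear[OF bounded_bilinear_wedge2])

lemma tnorm_scaleR: "tnorm (r *\<^sub>R a) = \<bar>r\<bar> * tnorm a"
proof -
  have "\<bar>tform (r *\<^sub>R a) (r *\<^sub>R a)\<bar> = r\<^sup>2 * \<bar>tform a a\<bar>"
    by (simp add: tform_scaleR abs_mult power2_eq_square mult.assoc[symmetric])
  then show ?thesis by (simp add: tnorm_def real_sqrt_mult)
qed

text \<open>These vectors form the direction space of the affine hyperplane
  \<open>x $ 0 - x $ 1 = 2\<close> that contains \<open>E3\<close>. All derivatives of a curve in
  \<open>E3\<close> lie there, and on it the Lorentz form sees only \<open>u\<close>.\<close>

definition vert :: "real \<Rightarrow> real ^ 3 \<Rightarrow> real ^ 5" where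
  "vert p u = (\<chi> i. if i = 0 then p else if i = 1 then p
     else if i = 2 then u $ 1 else if i = 3 then u $ 2 else u $ 3)"

lemma lform_vert: "lform (vert p u) (vert q w) = u \<bullet> w"
  by (simp add: lform_expand vert_def inner_vec_def sum_3)

lemma lform_flat_vert: "lform (flat_point x) (vert p u) = x \<bullet> u - 2 * p"
  by (simp add: lform_expand vert_def flat_point_def inner_vec_def sum_3 algebra_simps)

lemma lform_flat: "lform (flat_point x) (flat_point x) = 0"
  by (simp add: lform_expand flat_point_def inner_vec_def sum_3) (simp add: field_simps)

lemma has_vector_derivative_vert:
  assumes "(p has_vector_derivative p') (at t within I)" "(u has_vector_derivative u') (at t within I)"
  shows "((\<lambda>t. vert (p t) (u t)) has_vector_derivative vert p' u') (at t within I)"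
proof -
  have "linear (\<lambda>(p, u). vert p u)"
    by (auto intro!: linearI simp: vert_def vec_eq_iff algebra_simps)
  then have "bounded_linear (\<lambda>(p, u). vert p u)"
    by (simp add: linear_conv_bounded_linear)
  from bounded_linear.has_vector_derivative[OF this has_vector_derivative_Pair[OF assms]]
  show ?thesis by simp
qed

lemma flat_point_conv: "flat_point x = (axis 0 1 - axis 1 1) + vert (x \<bullet> x / 4) x"
  by (auto simp: flat_point_def vert_def vec_eq_iff axis_def)

lemma has_vector_derivative_flat_point:
  assumes "(x has_vector_derivative x') (at t within I)"
  shows "((\<lambda>t. flat_point (x t)) has_vector_derivative vert (x t \<bullet> x' / 2) x') (at t within I)"
proof -
  have "((\<lambda>t. x t \<bullet> x t * (1/4)) has_vector_derivative (x t \<bullet> x' + x' \<bullet> x t) * (1/4)) (at t within I)"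
    by (intro has_vector_derivative_mult_left bounded_bilinear.has_vector_derivative[OF bounded_bilinear_inner] assms)
  from has_vector_derivative_vert[OF this assms]
  have "((\<lambda>t. vert (x t \<bullet> x t / 4) (x t)) has_vector_derivative vert (x t \<bullet> x' / 2) x') (at t within I)"
    by (simp add: inner_commute)
  from has_vector_derivative_add[OF has_vector_derivative_const this]
  show ?thesis unfolding flat_point_conv by simp
qed


section \<open>Chords of lightlike curves\<close>

lemma mean_value_power_bound_0:
  fixes f :: "real \<Rightarrow> 'a::real_normed_vector"
  assumes "f t = 0" "0 \<le> C"
    and deriv: "\<And>u. u \<in> {t..s} \<Longrightarrow> (f has_vector_derivative f' u) (at u within {t..s})"
    and bound: "\<And>u. u \<in> {t..s} \<Longrightarrow> norm (f' u) \<le> C * (u - t) ^ n"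
    and "w \<in> {t..s}"
  shows "norm (f w) \<le> C * (w - t) ^ Suc n"
proof -
  have "norm (f w - f t) \<le> C * (w - t) ^ Suc n"
  proof (rule mean_value_power_bound)
    show "(f has_vector_derivative f' u) (at u within {t..w})" if "u \<in> {t..w}" for u
      using that assms(5) by (intro has_vector_derivative_within_subset[OF deriv]) auto
  qed (use assms in auto)
  then show ?thesis using assms(1) by simp
qed

text \<open>Fix \<open>t\<close> and put \<open>D u = g u - g t\<close>. Since
  \<open>B (g1 u) (g1 u)\<close> and \<open>B (g1 u) (g2 u)\<close> vanish, the first three
  derivatives of \<open>B (D u) (D u)\<close> are \<open>2 * B (g1 u) (D u)\<close>,
  \<open>2 * B (g2 u) (D u)\<close> and \<open>2 * B (g3 u) (D u)\<close>, all zero at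
  \<open>t\<close>. The fourth is \<open>2 * (B (g3 u) (g1 u) + B (g4 u) (D u))\<close>, close to
  \<open>- 2 * B (g2 t) (g2 t)\<close>; four integrations divide this by 24. Uniform continuity
  makes \<delta> independent of \<open>t\<close>.\<close>

lemma lightlike_curve_expansion:
  fixes B :: "'a::real_normed_vector \<Rightarrow> 'a \<Rightarrow> real"
  assumes B: "bounded_bilinear B" and sym: "\<And>u v. B u v = B v u"
    and ab: "a < b"
    and g0: "\<And>t. t \<in> {a..b} \<Longrightarrow> (g has_vector_derivative g1 t) (at t within {a..b})"
    and g1: "\<And>t. t \<in> {a..b} \<Longrightarrow> (g1 has_vector_derivative g2 t) (at t within {a..b})"
    and g2: "\<And>t. t \<in> {a..b} \<Longrightarrow> (g2 has_vector_derivative g3 t) (at t within {a..b})"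
    and g3: "\<And>t. t \<in> {a..b} \<Longrightarrow> (g3 has_vector_derivative g4 t) (at t within {a..b})"
    and g4: "continuous_on {a..b} g4"
    and lightlike: "\<And>t. t \<in> {a..b} \<Longrightarrow> B (g1 t) (g1 t) = 0"
    and e: "0 < e"
  shows "\<exists>\<delta>>0. \<forall>t\<in>{a..b}. \<forall>s\<in>{a..b}. t \<le> s \<and> s - t < \<delta> \<longrightarrow>
    \<bar>B (g s - g t) (g s - g t) + B (g2 t) (g2 t) / 12 * (s - t) ^ 4\<bar> \<le> e * (s - t) ^ 4"
proof -
  interpret B: bounded_bilinear B by fact
  let ?I = "{a..b}"
  have nb: "at t within ?I \<noteq> bot" if "t \<in> ?I" for t
    using at_within_Icc_neq_bot ab that by blast
  note dB = bounded_bilinear.has_vector_derivative[OF B]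
  \<comment> \<open>Differentiating the lightlike condition twice gives \<open>B12\<close> and
    \<open>B13\<close>.\<close>
  have B12: "B (g1 t) (g2 t) = 0" if t: "t \<in> ?I" for t
  proof -
    have "((\<lambda>t. B (g1 t) (g1 t)) has_vector_derivative B (g1 t) (g2 t) + B (g2 t) (g1 t)) (at t within ?I)"
      using t by (intro dB g1)
    moreover have "((\<lambda>t. B (g1 t) (g1 t)) has_vector_derivative 0) (at t within ?I)"
      using t lightlike by (intro has_vector_derivative_transform[OF t _ has_vector_derivative_const]) auto
    ultimately show ?thesis
      using vector_derivative_unique_within[OF nb[OF t]] sym[of "g2 t" "g1 t"] by fastforce
  qed
  have B13: "B (g1 t) (g3 t) = - B (g2 t) (g2 t)" if t: "t \<in> ?I" for t
  proof -
    have "((\<lambda>t. B (g1 t) (g2 t)) has_vector_derivative B (g1 t) (g3 t) + B (g2 t) (g2 t)) (at t within ?I)"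
      using t by (intro dB g1 g2)
    moreover have "((\<lambda>t. B (g1 t) (g2 t)) has_vector_derivative 0) (at t within ?I)"
      using t B12 by (intro has_vector_derivative_transform[OF t _ has_vector_derivative_const]) auto
    ultimately show ?thesis
      using vector_derivative_unique_within[OF nb[OF t]] by fastforce
  qed
  have cont: "continuous_on ?I g" "continuous_on ?I g2"
    by (rule continuous_on_vector_derivative[OF g0] continuous_on_vector_derivative[OF g2]; assumption)+
  define K where "K = (\<lambda>t. B (g2 t) (g2 t))"
  have "continuous_on ?I K"
    unfolding K_def using cont(2) by (intro B.continuous_on)
  then have ucK: "uniformly_continuous_on ?I K"
    by (simp add: compact_uniformly_continuous)
  have ucg: "uniformly_continuous_on ?I g"
    using cont(1) by (simp add: compact_uniformly_continuous)
  obtain N where N: "N > 0" "\<And>u v. norm (B u v) \<le> norm u * norm v * N"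
    using B.pos_bounded by blast
  have "compact (g4 ` ?I)" using g4 by (intro compact_continuous_image) auto
  then obtain M where M: "M > 0" "\<And>t. t \<in> ?I \<Longrightarrow> norm (g4 t) \<le> M"
    using compact_imp_bounded bounded_pos by (metis imageI)
  \<comment> \<open>Makes the term with \<open>g4\<close> at most \<open>M * e1 * N = e / 4\<close>.
    The fourth derivative is twice a sum of two terms, so two errors of \<open>e / 4\<close> amount
    to \<open>e\<close>.\<close>
  define e1 where "e1 = e / (4 * M * N)"
  have "e1 > 0" using e M N by (simp add: e1_def)
  obtain \<delta>1 where \<delta>1: "\<delta>1 > 0" "\<And>t s. t \<in> ?I \<Longrightarrow> s \<in> ?I \<Longrightarrow> dist s t < \<delta>1 \<Longrightarrow> dist (g s) (g t) < e1"
    using ucg \<open>e1 > 0\<close> unfolding uniformly_continuous_on_def by metis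
  obtain \<delta>2 where \<delta>2: "\<delta>2 > 0" "\<And>t s. t \<in> ?I \<Longrightarrow> s \<in> ?I \<Longrightarrow> dist s t < \<delta>2 \<Longrightarrow> dist (K s) (K t) < e / 4"
    using ucK e unfolding uniformly_continuous_on_def by (metis zero_less_divide_iff zero_less_numeral)
  show ?thesis
  proof (intro exI[of _ "min \<delta>1 \<delta>2"] conjI ballI impI)
    show "min \<delta>1 \<delta>2 > 0" using \<delta>1 \<delta>2 by simp
    fix t s assume t: "t \<in> ?I" and s: "s \<in> ?I" and ts: "t \<le> s \<and> s - t < min \<delta>1 \<delta>2"
    define J where "J = {t..s}"
    have sub: "J \<subseteq> ?I" using t s by (auto simp: J_def)
    have dg: "(g has_vector_derivative g1 u) (at u within J)"
      "(g1 has_vector_derivative g2 u) (at u within J)"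
      "(g2 has_vector_derivative g3 u) (at u within J)"
      "(g3 has_vector_derivative g4 u) (at u within J)" if "u \<in> J" for u
    proof -
      have "u \<in> ?I" using that sub by blast
      note * = has_vector_derivative_within_subset[OF _ sub]
      from *[OF g0] *[OF g1] *[OF g2] *[OF g3] \<open>u \<in> ?I\<close>
      show "(g has_vector_derivative g1 u) (at u within J)"
        "(g1 has_vector_derivative g2 u) (at u within J)"
        "(g2 has_vector_derivative g3 u) (at u within J)"
        "(g3 has_vector_derivative g4 u) (at u within J)" by blast+
    qed
    have dD: "((\<lambda>u. g u - g t) has_vector_derivative g1 u) (at u within J)" if "u \<in> J" for u
      using has_vector_derivative_diff[OF dg(1)[OF that] has_vector_derivative_const] by simp
    have dp: "((\<lambda>u. c * (u - t) ^ Suc n) has_vector_derivative c * (real (Suc n) * (u - t) ^ n)) (at u within J)"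
      for c u n
      unfolding has_real_derivative_iff_has_vector_derivative[symmetric]
      by (rule derivative_eq_intros refl | simp)+
    \<comment> \<open>The fourth derivative is within \<open>e\<close> of \<open>- 2 * K t\<close>.
      The trivial factors give the shape that \<open>step\<close> expects for
      \<open>n = 0\<close>.\<close>
    have b4: "norm (2 * (B (g3 u) (g1 u) + B (g4 u) (g u - g t)) + 2 * K t * (real (Suc 0) * (u - t) ^ 0)) \<le> e * (u - t) ^ 0"
      if u: "u \<in> J" for u
    proof -
      have uI: "u \<in> ?I" using u sub by auto
      have d: "dist u t < \<delta>1" "dist u t < \<delta>2" using u ts by (auto simp: J_def dist_real_def)
      have "norm (B (g4 u) (g u - g t)) \<le> norm (g4 u) * norm (g u - g t) * N" by (rule N)
      also have "\<dots> \<le> M * e1 * N"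
        using M(2)[OF uI] M(1) N(1) \<delta>1(2)[OF t uI d(1)]
        by (intro mult_right_mono mult_mono) (auto simp: dist_norm)
      also have "\<dots> = e / 4" using M(1) N(1) by (simp add: e1_def)
      finally have 1: "\<bar>B (g4 u) (g u - g t)\<bar> \<le> e / 4" by simp
      have 2: "\<bar>K u - K t\<bar> < e / 4" using \<delta>2(2)[OF t uI d(2)] by (simp add: dist_real_def)
      have 3: "B (g3 u) (g1 u) = - K u" using B13[OF uI] sym[of "g3 u" "g1 u"] by (simp add: K_def)
      show ?thesis using 1 2 e by (simp add: 3) (smt (verit, best))
    qed
    \<comment> \<open>One integration from \<open>t\<close>, where \<open>f\<close> vanishes; the
      error constant \<open>e\<close> is kept while the power of \<open>u - t\<close> rises by
      one.\<close>
    have step: "norm (f u + c * (u - t) ^ Suc n) \<le> e * (u - t) ^ Suc n"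
      if "f t = 0" "\<And>u. u \<in> J \<Longrightarrow> (f has_vector_derivative f' u) (at u within J)"
        "\<And>u. u \<in> J \<Longrightarrow> norm (f' u + c * (real (Suc n) * (u - t) ^ n)) \<le> e * (u - t) ^ n" "u \<in> J"
      for f f' :: "real \<Rightarrow> real" and c n u
      using that(1,4) e unfolding J_def
      by (intro mean_value_power_bound_0[where f = "\<lambda>u. f u + c * (u - t) ^ Suc n"
            and f' = "\<lambda>u. f' u + c * (real (Suc n) * (u - t) ^ n)" and s = s]
          has_vector_derivative_add dp[unfolded J_def] that(2,3)[unfolded J_def]) auto
    note dm = has_vector_derivative_mult_right
    \<comment> \<open>From \<open>b3\<close> to \<open>b0\<close> the coefficients are
      \<open>2 * K t\<close>, \<open>K t\<close>, \<open>K t / 3\<close> and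
      \<open>K t / 12\<close>, each the previous one divided by the new exponent.\<close>
    have b3: "norm (2 * B (g3 u) (g u - g t) + 2 * K t * (u - t) ^ Suc 0) \<le> e * (u - t) ^ Suc 0"
      if "u \<in> J" for u
      by (rule step[OF _ dm[OF dB[OF dg(4) dD]] b4 that]) (auto simp: B.zero_right)
    have b2: "norm (2 * B (g2 u) (g u - g t) + K t * (u - t) ^ Suc (Suc 0)) \<le> e * (u - t) ^ Suc (Suc 0)"
      if "u \<in> J" for u
    proof (rule step[OF _ dm[OF dB[OF dg(3) dD]] _ that])
      show "norm (2 * (B (g2 u) (g1 u) + B (g3 u) (g u - g t)) + K t * (real (Suc (Suc 0)) * (u - t) ^ Suc 0))
          \<le> e * (u - t) ^ Suc 0" if "u \<in> J" for u
        using b3[OF that] B12[of u] sub that sym[of "g2 u" "g1 u"] by (auto simp: mult_ac)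
    qed (auto simp: B.zero_right)
    have b1: "norm (2 * B (g1 u) (g u - g t) + K t / 3 * (u - t) ^ Suc (Suc (Suc 0)))
        \<le> e * (u - t) ^ Suc (Suc (Suc 0))" if "u \<in> J" for u
    proof (rule step[OF _ dm[OF dB[OF dg(2) dD]] _ that])
      show "norm (2 * (B (g1 u) (g1 u) + B (g2 u) (g u - g t))
          + K t / 3 * (real (Suc (Suc (Suc 0))) * (u - t) ^ Suc (Suc 0))) \<le> e * (u - t) ^ Suc (Suc 0)"
        if "u \<in> J" for u
      proof -
        have "B (g1 u) (g1 u) = 0" using lightlike sub that by blast
        moreover have "K t / 3 * (real (Suc (Suc (Suc 0))) * (u - t) ^ Suc (Suc 0)) = K t * (u - t) ^ Suc (Suc 0)"
          by (simp del: power_Suc)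
        ultimately show ?thesis using b2[OF that] by (simp del: power_Suc of_nat_Suc)
      qed
    qed (auto simp: B.zero_right)
    have b0: "norm (B (g u - g t) (g u - g t) + K t / 12 * (u - t) ^ Suc (Suc (Suc (Suc 0))))
        \<le> e * (u - t) ^ Suc (Suc (Suc (Suc 0)))" if "u \<in> J" for u
    proof (rule step[OF _ dB[OF dD dD] _ that])
      show "norm ((B (g u - g t) (g1 u) + B (g1 u) (g u - g t))
          + K t / 12 * (real (Suc (Suc (Suc (Suc 0)))) * (u - t) ^ Suc (Suc (Suc 0))))
          \<le> e * (u - t) ^ Suc (Suc (Suc 0))" if "u \<in> J" for u
      proof -
        have "K t / 12 * (real (Suc (Suc (Suc (Suc 0)))) * (u - t) ^ Suc (Suc (Suc 0))) = K t / 3 * (u - t) ^ Suc (Suc (Suc 0))"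
          by (simp del: power_Suc)
        then show ?thesis using b1[OF that] sym[of "g u - g t" "g1 u"] by (simp del: power_Suc of_nat_Suc)
      qed
    qed (auto simp: B.zero_right)
    show "\<bar>B (g s - g t) (g s - g t) + B (g2 t) (g2 t) / 12 * (s - t) ^ 4\<bar> \<le> e * (s - t) ^ 4"
      using b0[of s] ts by (simp add: K_def J_def eval_nat_numeral)
  qed
qed


section \<open>Sums over fine subdivisions\<close>

text \<open>The increments of \<open>F\<close> telescope to \<open>F b - F a\<close>, and the local
  errors add up to at most \<open>e\<close> times the total length \<open>b - a\<close>.\<close>

lemma sum_tendsto_mesh_to_0:
  fixes f :: "real \<Rightarrow> real \<Rightarrow> real" and F :: "real \<Rightarrow> real"
  assumes ab: "a \<le> b"
    and approx: "\<And>e. e > 0 \<Longrightarrow> \<exists>\<delta>>0. \<forall>s u. a \<le> s \<and> s < u \<and> u \<le> b \<and> u - s < \<delta> \<longrightarrow>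
      \<bar>f s u - (F u - F s)\<bar> \<le> e * (u - s)"
  shows "((\<lambda>ts. \<Sum>i<length ts - 1. f (ts ! i) (ts ! Suc i)) \<longlongrightarrow> F b - F a) (mesh_to_0 a b)"
proof (rule tendstoI)
  fix e :: real assume e: "e > 0"
  \<comment> \<open>The summand 1 keeps the denominator positive for \<open>a = b\<close> and the
    final estimate strict.\<close>
  define e' where "e' = e / (b - a + 1)"
  have e': "e' > 0" "e' * (b - a) < e" using e ab by (simp_all add: e'_def field_simps)
  obtain \<delta> where \<delta>: "\<delta> > 0"
    "\<And>s u. a \<le> s \<Longrightarrow> s < u \<Longrightarrow> u \<le> b \<Longrightarrow> u - s < \<delta> \<Longrightarrow> \<bar>f s u - (F u - F s)\<bar> \<le> e' * (u - s)"
    using approx[OF e'(1)] by blast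
  show "\<forall>\<^sub>F ts in mesh_to_0 a b. dist (\<Sum>i<length ts - 1. f (ts ! i) (ts ! Suc i)) (F b - F a) < e"
    unfolding eventually_mesh_to_0
  proof (intro exI[of _ \<delta>] conjI ballI impI)
    fix ts assume ts: "ts \<in> subdivisions a b" and mesh: "mesh_less ts \<delta>"
    define n where "n = length ts - 1"
    have ne: "ts \<noteq> []" and so: "sorted_wrt (<) ts" and "hd ts = a" "last ts = b"
      using ts by (auto simp: subdivisions_def)
    then have ends: "ts ! 0 = a" "ts ! n = b" and len: "length ts = Suc n"
      by (auto simp: n_def hd_conv_nth last_conv_nth)
    have lt: "ts ! i < ts ! j" if "i < j" "j \<le> n" for i j
      using sorted_wrt_nth_less[OF so] that len by simp
    have tele: "(\<Sum>i<n. G (ts ! Suc i) - G (ts ! i)) = G b - G a" for G :: "real \<Rightarrow> real"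
      using sum_lessThan_telescope[of "\<lambda>i. G (ts ! i)" n] ends by simp
    have "\<bar>(\<Sum>i<n. f (ts ! i) (ts ! Suc i)) - (F b - F a)\<bar>
        = \<bar>\<Sum>i<n. f (ts ! i) (ts ! Suc i) - (F (ts ! Suc i) - F (ts ! i))\<bar>"
      using tele[of F] by (simp add: sum_subtractf)
    also have "\<dots> \<le> (\<Sum>i<n. e' * (ts ! Suc i - ts ! i))"
    proof (rule order_trans[OF sum_abs sum_mono])
      fix i assume i: "i \<in> {..<n}"
      have "a \<le> ts ! i" using lt[of 0 i] ends i by (cases i) auto
      moreover have "ts ! Suc i \<le> b" using lt[of "Suc i" n] ends i by (cases "Suc i = n") auto
      moreover have "ts ! Suc i - ts ! i < \<delta>"
        using mesh i by (auto simp: mesh_less_def n_def)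
      ultimately show "\<bar>f (ts ! i) (ts ! Suc i) - (F (ts ! Suc i) - F (ts ! i))\<bar> \<le> e' * (ts ! Suc i - ts ! i)"
        using \<delta>(2) lt[of i "Suc i"] i by simp
    qed
    also have "\<dots> = e' * (b - a)"
      using tele[of "\<lambda>x. x"] by (simp add: sum_distrib_left[symmetric])
    finally show "dist (\<Sum>i<length ts - 1. f (ts ! i) (ts ! Suc i)) (F b - F a) < e"
      using e' by (simp add: dist_real_def n_def)
  qed (use \<delta> in auto)
qed

section \<open>Hoelder estimates and sums of fourth roots\<close>

lemma root_4_eq_sqrt: "root 4 x = sqrt (sqrt x)"
  using real_root_mult_exp[of 2 2 x] by (simp add: sqrt_def)

lemma abs_sqrt_diff_le:
  assumes "0 \<le> x" "0 \<le> y"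
  shows "\<bar>sqrt x - sqrt y\<bar> \<le> sqrt \<bar>x - y\<bar>"
proof -
  have "sqrt u \<le> sqrt v + sqrt (u - v)" if "0 \<le> v" "v \<le> u" for u v
    using sqrt_add_le_add_sqrt[of v "u - v"] that by simp
  from this[of x y] this[of y x] assms show ?thesis by (cases "x \<le> y") auto
qed

text \<open>Two applications of the subadditivity of the square root. The estimate needs no positive
  lower bound, so it also serves at zeros of \<open>Q\<close>, where the fourth root is not
  Lipschitz.\<close>

lemma abs_root_4_diff_le:
  assumes "0 \<le> x" "0 \<le> y"
  shows "\<bar>root 4 x - root 4 y\<bar> \<le> root 4 \<bar>x - y\<bar>"
proof -
  have "\<bar>sqrt (sqrt x) - sqrt (sqrt y)\<bar> \<le> sqrt \<bar>sqrt x - sqrt y\<bar>"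
    using assms by (intro abs_sqrt_diff_le) auto
  also have "\<dots> \<le> sqrt (sqrt \<bar>x - y\<bar>)"
    using assms by (intro real_sqrt_le_mono abs_sqrt_diff_le)
  finally show ?thesis by (simp add: root_4_eq_sqrt)
qed

text \<open>With \<open>h = u - s\<close>, both \<open>root 4 (12 * d s u)\<close> and
  \<open>\<rho> u - \<rho> s\<close> are within \<open>e / 2 * h\<close> of
  \<open>h * root 4 (Q s)\<close>: the first by the Hoelder estimate, the second by the mean value
  theorem.\<close>

lemma sum_root_4_tendsto:
  fixes d :: "real \<Rightarrow> real \<Rightarrow> real" and Q \<rho> :: "real \<Rightarrow> real"
  assumes t: "0 \<le> t" "t \<le> T"
    and Q: "continuous_on {0..T} Q" "\<And>s. s \<in> {0..T} \<Longrightarrow> 0 \<le> Q s"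
    and d: "\<And>s u. 0 \<le> d s u"
    and approx: "\<And>e. e > 0 \<Longrightarrow> \<exists>\<delta>>0. \<forall>s\<in>{0..T}. \<forall>u\<in>{0..T}. s \<le> u \<and> u - s < \<delta> \<longrightarrow>
      \<bar>d s u - Q s / 12 * (u - s) ^ 4\<bar> \<le> e * (u - s) ^ 4"
    and \<rho>: "\<And>s. s \<in> {0..T} \<Longrightarrow> (\<rho> has_real_derivative root 4 (Q s)) (at s within {0..T})"
  shows "((\<lambda>ts. \<Sum>i<length ts - 1. root 4 (d (ts ! i) (ts ! Suc i))) \<longlongrightarrow> (\<rho> t - \<rho> 0) / root 4 12)
    (mesh_to_0 0 t)"
proof -
  define q where "q s = root 4 (Q s)" for s
  have uq: "uniformly_continuous_on {0..T} q"
    unfolding q_def using Q(1) by (intro compact_uniformly_continuous continuous_on_real_root) auto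
  have "\<exists>\<delta>>0. \<forall>s u. 0 \<le> s \<and> s < u \<and> u \<le> t \<and> u - s < \<delta> \<longrightarrow>
      \<bar>root 4 12 * root 4 (d s u) - (\<rho> u - \<rho> s)\<bar> \<le> e * (u - s)" if e: "e > 0" for e
  proof -
    obtain \<delta>1 where \<delta>1: "\<delta>1 > 0"
      "\<And>s u. s \<in> {0..T} \<Longrightarrow> u \<in> {0..T} \<Longrightarrow> dist u s < \<delta>1 \<Longrightarrow> dist (q u) (q s) < e / 2"
      using uq e unfolding uniformly_continuous_on_def by (metis half_gt_zero)
    \<comment> \<open>Chosen so that multiplying by 12 and taking the fourth root leaves
      \<open>e / 2\<close>.\<close>
    have "(e / 2) ^ 4 / 12 > 0" using e by simp
    from approx[OF this] obtain \<delta>2 where \<delta>2: "\<delta>2 > 0"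
      "\<forall>s\<in>{0..T}. \<forall>u\<in>{0..T}. s \<le> u \<and> u - s < \<delta>2 \<longrightarrow>
        \<bar>d s u - Q s / 12 * (u - s) ^ 4\<bar> \<le> (e / 2) ^ 4 / 12 * (u - s) ^ 4"
      by (elim exE conjE) (rule that)
    show ?thesis
    proof (intro exI[of _ "min \<delta>1 \<delta>2"] conjI allI impI)
      fix s u assume su: "0 \<le> s \<and> s < u \<and> u \<le> t \<and> u - s < min \<delta>1 \<delta>2"
      then have I: "s \<in> {0..T}" "u \<in> {0..T}" using t by auto
      define h where "h = u - s"
      have h: "h > 0" using su by (simp add: h_def)
      have "\<bar>12 * d s u - Q s * h ^ 4\<bar> \<le> (e / 2 * h) ^ 4"
      proof -
        have "\<bar>d s u - Q s / 12 * h ^ 4\<bar> \<le> (e / 2) ^ 4 / 12 * h ^ 4"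
          using \<delta>2(2)[rule_format, OF I] su by (simp add: h_def)
        moreover have "12 * d s u - Q s * h ^ 4 = 12 * (d s u - Q s / 12 * h ^ 4)" by simp
        ultimately show ?thesis by (simp only: abs_mult power_mult_distrib)
      qed
      then have "root 4 \<bar>12 * d s u - Q s * h ^ 4\<bar> \<le> root 4 ((e / 2 * h) ^ 4)"
        by simp
      also have "\<dots> = e / 2 * h" using e h by (intro real_root_power_cancel) auto
      finally have r: "root 4 \<bar>12 * d s u - Q s * h ^ 4\<bar> \<le> e / 2 * h" .
      have "\<bar>root 4 (12 * d s u) - root 4 (Q s * h ^ 4)\<bar> \<le> e / 2 * h"
        using d[of s u] Q(2)[OF I(1)] by (intro order_trans[OF abs_root_4_diff_le r]) auto
      moreover have "root 4 (Q s * h ^ 4) = h * q s"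
        using h by (simp add: real_root_mult q_def real_root_power_cancel)
      ultimately have 1: "\<bar>root 4 12 * root 4 (d s u) - h * q s\<bar> \<le> e / 2 * h"
        by (simp add: real_root_mult)
      \<comment> \<open>Subtracting the linear function with slope \<open>q s\<close> leaves the
        derivative \<open>q w - q s\<close>, small by uniform continuity of
        \<open>q\<close>.\<close>
      have "norm ((\<rho> u - q s * u) - (\<rho> s - q s * s)) \<le> e / 2 * norm (u - s)"
      proof (rule field_differentiable_bound[of "{s..u}"])
        fix w assume w: "w \<in> {s..u}"
        have wI: "w \<in> {0..T}" and sub: "{s..u} \<subseteq> {0..T}" using w su t by auto
        have "(\<rho> has_real_derivative q w) (at w within {s..u})"
          using DERIV_subset[OF \<rho>[OF wI] sub] by (simp add: q_def)
        then show "((\<lambda>w. \<rho> w - q s * w) has_field_derivative q w - q s) (at w within {s..u})"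
          by (auto intro!: derivative_eq_intros)
        show "norm (q w - q s) \<le> e / 2"
          using \<delta>1(2)[OF I(1) wI] w su by (simp add: dist_real_def)
      qed (use su in auto)
      then have "\<bar>(\<rho> u - \<rho> s) - h * q s\<bar> \<le> e / 2 * h"
        using h by (simp add: h_def algebra_simps)
      with 1 show "\<bar>root 4 12 * root 4 (d s u) - (\<rho> u - \<rho> s)\<bar> \<le> e * (u - s)"
        unfolding h_def[symmetric] by linarith
    qed (use \<delta>1 \<delta>2 in auto)
  qed
  then have "((\<lambda>ts. \<Sum>i<length ts - 1. root 4 12 * root 4 (d (ts ! i) (ts ! Suc i))) \<longlongrightarrow> \<rho> t - \<rho> 0)
    (mesh_to_0 0 t)"
    using t by (intro sum_tendsto_mesh_to_0) auto
  from tendsto_divide[OF this tendsto_const[of "root 4 12"]] show ?thesis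
    by (simp add: sum_distrib_left[symmetric])
qed


section \<open>Osculating circles from 2-jets\<close>

text \<open>For \<open>a \<noteq> 0\<close> the ray is cut out by two closed conditions:
  \<open>y\<close> equals its projection to the line of \<open>a\<close>, and
  \<open>y \<bullet> a\<close> is nonnegative. The end point 0 must belong to it.\<close>

lemma closed_ray_scaleR:
  fixes a :: "'a::real_inner"
  shows "closed {r *\<^sub>R a | r. 0 \<le> r}"
proof (cases "a = 0")
  case True
  then have "{r *\<^sub>R a | r. 0 \<le> r} = {0}" by auto
  then show ?thesis by simp
next
  case False
  have "{r *\<^sub>R a | r. 0 \<le> r} = {y. y = ((y \<bullet> a) / (a \<bullet> a)) *\<^sub>R a \<and> 0 \<le> y \<bullet> a}"
  proof (intro set_eqI iffI)
    fix y assume "y \<in> {y. y = ((y \<bullet> a) / (a \<bullet> a)) *\<^sub>R a \<and> 0 \<le> y \<bullet> a}"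
    then have "y = ((y \<bullet> a) / (a \<bullet> a)) *\<^sub>R a" "0 \<le> (y \<bullet> a) / (a \<bullet> a)" by auto
    then show "y \<in> {r *\<^sub>R a | r. 0 \<le> r}" by blast
  next
    fix y assume "y \<in> {r *\<^sub>R a | r. 0 \<le> r}"
    then obtain r where "y = r *\<^sub>R a" "0 \<le> r" by blast
    then show "y \<in> {y. y = ((y \<bullet> a) / (a \<bullet> a)) *\<^sub>R a \<and> 0 \<le> y \<bullet> a}"
      using False by simp
  qed
  then show ?thesis
    using False
    by (simp only:) (intro closed_Collect_conj closed_Collect_eq closed_Collect_le continuous_intros; simp)
qed

text \<open>The limit is one-sided because points of an arc will be taken with increasing
  parameters.\<close>

lemma tendsto_difference_quotient_at_right:
  assumes "(c has_vector_derivative c') (at t)"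
  shows "((\<lambda>v. (c v - c t) /\<^sub>R (v - t)) \<longlongrightarrow> c') (at_right t)"
proof -
  have "((\<lambda>v. ((c v - c t) - (v - t) *\<^sub>R c') /\<^sub>R norm (v - t)) \<longlongrightarrow> 0) (at_right t)"
    using has_vector_derivative_at_within[OF assms, of "{t<..}"]
    unfolding has_vector_derivative_def has_derivative_within by (simp add: diff_diff_eq divide_inverse)
  moreover have "\<forall>\<^sub>F v in at_right t. ((c v - c t) - (v - t) *\<^sub>R c') /\<^sub>R norm (v - t) = (c v - c t) /\<^sub>R (v - t) - c'"
    by (auto simp: eventually_at_filter scaleR_diff_right)
  ultimately have "((\<lambda>v. (c v - c t) /\<^sub>R (v - t) - c') \<longlongrightarrow> 0) (at_right t)"
    by (rule Lim_transform_eventually)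
  then show ?thesis by (rule LIM_zero_cancel)
qed

text \<open>Peano form of Taylor's theorem, with a second derivative at \<open>t\<close> alone: the
  remainder \<open>f\<close> has derivative \<open>c1 u - c1 t - (u - t) *\<^sub>R c2\<close>, which
  is small relative to \<open>u - t\<close>, so the mean value bound makes \<open>f\<close> small
  relative to the square.\<close>

lemma tendsto_second_difference_quotient_at_right:
  fixes c :: "real \<Rightarrow> 'a::real_normed_vector"
  assumes "t < b"
    and c: "\<And>u. t \<le> u \<Longrightarrow> u < b \<Longrightarrow> (c has_vector_derivative c1 u) (at u)"
    and c1: "(c1 has_vector_derivative c2) (at t)"
  shows "((\<lambda>v. (c v - c t - (v - t) *\<^sub>R c1 t) /\<^sub>R (v - t)\<^sup>2) \<longlongrightarrow> c2 /\<^sub>R 2) (at_right t)"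
proof (rule LIM_zero_cancel, rule tendstoI)
  fix e :: real assume e: "e > 0"
  have "\<forall>\<^sub>F u in at_right t. norm ((c1 u - c1 t) /\<^sub>R (u - t) - c2) < e / 2"
    using tendstoD[OF tendsto_difference_quotient_at_right[OF c1], of "e / 2"] e by (simp add: dist_norm)
  then obtain d where d: "d > t" "\<And>u. t < u \<Longrightarrow> u < d \<Longrightarrow> norm ((c1 u - c1 t) /\<^sub>R (u - t) - c2) < e / 2"
    unfolding eventually_at_right_field by blast
  have main: "norm ((c v - c t - (v - t) *\<^sub>R c1 t) /\<^sub>R (v - t)\<^sup>2 - c2 /\<^sub>R 2) < e"
    if v: "t < v" "v < min d b" for v
  proof -
    define f where "f u = c u - c t - (u - t) *\<^sub>R c1 t - ((u - t)\<^sup>2 / 2) *\<^sub>R c2" for u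
    have "norm (f v) \<le> e / 2 * (v - t) ^ Suc 1"
    proof (rule mean_value_power_bound_0[where s = v and f' = "\<lambda>u. c1 u - c1 t - (u - t) *\<^sub>R c2"])
      fix u assume u: "u \<in> {t..v}"
      have q: "((\<lambda>u. (u - t)\<^sup>2 / 2) has_real_derivative u - t) (at u within {t..v})"
        by (auto intro!: derivative_eq_intros)
      have l: "((\<lambda>u. u - t) has_real_derivative 1) (at u within {t..v})"
        by (auto intro!: derivative_eq_intros)
      have "(f has_vector_derivative c1 u - 0 - ((u - t) *\<^sub>R 0 + 1 *\<^sub>R c1 t) - (((u - t)\<^sup>2 / 2) *\<^sub>R 0 + (u - t) *\<^sub>R c2))
          (at u within {t..v})"
        unfolding f_def using u v
        by (intro has_vector_derivative_diff has_vector_derivative_const has_vector_derivative_scaleR q l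
            has_vector_derivative_at_within[OF c]) auto
      then show "(f has_vector_derivative c1 u - c1 t - (u - t) *\<^sub>R c2) (at u within {t..v})" by simp
      show "norm (c1 u - c1 t - (u - t) *\<^sub>R c2) \<le> e / 2 * (u - t) ^ 1"
      proof (cases "u = t")
        case False
        then have ut: "u > t" using u by simp
        have "c1 u - c1 t - (u - t) *\<^sub>R c2 = (u - t) *\<^sub>R ((c1 u - c1 t) /\<^sub>R (u - t) - c2)"
          using ut by (simp add: scaleR_diff_right)
        then have "norm (c1 u - c1 t - (u - t) *\<^sub>R c2) = (u - t) * norm ((c1 u - c1 t) /\<^sub>R (u - t) - c2)"
          using ut by (metis norm_scaleR abs_of_pos diff_gt_0_iff_gt)
        also have "\<dots> \<le> (u - t) * (e / 2)"
          using d(2)[OF ut] ut u v by (intro mult_left_mono) auto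
        finally show ?thesis by (simp add: mult.commute)
      qed simp
    qed (use v e in \<open>auto simp: f_def\<close>)
    moreover have "(c v - c t - (v - t) *\<^sub>R c1 t) /\<^sub>R (v - t)\<^sup>2 - c2 /\<^sub>R 2 = f v /\<^sub>R (v - t)\<^sup>2"
      using v by (simp add: f_def scaleR_diff_right field_simps)
    ultimately have "norm ((c v - c t - (v - t) *\<^sub>R c1 t) /\<^sub>R (v - t)\<^sup>2 - c2 /\<^sub>R 2) \<le> e / 2"
    proof -
      assume f: "norm (f v) \<le> e / 2 * (v - t) ^ Suc 1"
        and eq: "(c v - c t - (v - t) *\<^sub>R c1 t) /\<^sub>R (v - t)\<^sup>2 - c2 /\<^sub>R 2 = f v /\<^sub>R (v - t)\<^sup>2"
      have inv: "inverse h * inverse h * (e * (h * h) / 2) = e / 2" if "h \<noteq> 0" for h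
        using that by (simp add: field_simps)
      have "inverse ((v - t)\<^sup>2) * norm (f v) \<le> inverse ((v - t)\<^sup>2) * (e / 2 * (v - t) ^ Suc 1)"
        using f by (intro mult_left_mono) auto
      also have "\<dots> = e / 2"
        using v inv[of "v - t"] by (simp add: power2_eq_square mult.assoc)
      finally show ?thesis unfolding eq by simp
    qed
    then show ?thesis using e by linarith
  qed
  show "\<forall>\<^sub>F v in at_right t. dist ((c v - c t - (v - t) *\<^sub>R c1 t) /\<^sub>R (v - t)\<^sup>2 - c2 /\<^sub>R 2) 0 < e"
    unfolding eventually_at_right_field using main d \<open>t < b\<close>
    by (intro exI[of _ "min d b"]) auto
qed

text \<open>Wedges of three points with increasing parameters all lie on the ray of the positive
  bases. With first point \<open>t\<close>, let the second and then the third point tend to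
  \<open>t\<close> from the right: difference quotients lead to the wedge of the 2-jet on the same
  ray, and normalising removes the remaining factor.\<close>

lemma oriented_circle_eq_jet:
  assumes circ: "oriented_circle M W J c \<theta>" and t: "t \<in> J"
    and nz: "wedge3 (c t) (vd J c t) (vd J (vd J c) t) \<noteq> 0" (is "?w \<noteq> 0")
  shows "\<theta> = ?w /\<^sub>R tnorm ?w"
proof -
  have arc: "circle_arc M W J c" using circ by (simp add: oriented_circle_def)
  obtain a b where J: "J = {a<..<b}" using arc by (auto simp: circle_arc_def)
  have smooth: "smooth_on J c" using arc by (simp add: circle_arc_def)
  obtain x y z where pos: "positive_basis W J c x y z" and \<theta>: "\<theta> = wedge3 x y z /\<^sub>R tnorm (wedge3 x y z)"
    using circ by (auto simp: oriented_circle_def)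
  define \<omega> where "\<omega> = wedge3 x y z"
  \<comment> \<open>The closed ray, with \<open>r = 0\<close> allowed, so that membership survives
    limits.\<close>
  define K where "K = {r *\<^sub>R \<omega> | r. 0 \<le> r}"
  have K_scale: "r *\<^sub>R y \<in> K" if "y \<in> K" "r \<ge> 0" for r y
  proof -
    obtain r' where "y = r' *\<^sub>R \<omega>" "0 \<le> r'" using \<open>y \<in> K\<close> unfolding K_def by blast
    then have "r *\<^sub>R y = (r * r') *\<^sub>R \<omega>" "0 \<le> r * r'" using \<open>r \<ge> 0\<close> by auto
    then show ?thesis unfolding K_def by blast
  qed
  have nb: "at u within J \<noteq> bot" if "u \<in> J" for u
    using that unfolding J by (rule at_within_Ioo_neq_bot)
  have C: "C_diff (Suc (Suc 0)) J c" using smooth by (rule smooth_on_imp_C_diff)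
  have at_eq: "at u within J = at u" if "u \<in> J" for u
    using that at_within_open[of u J] by (simp add: J)
  have dc: "(c has_vector_derivative vd J c u) (at u)" if "u \<in> J" for u
    using has_vector_derivative_vd[OF C that] at_eq[OF that] by simp
  have dc1: "(vd J c has_vector_derivative vd J (vd J c) u) (at u)" if "u \<in> J" for u
    using has_vector_derivative_vd[OF C_diff_vd[OF C nb] that] at_eq[OF that] by simp
  have lim: "P \<in> K" if "(f \<longlongrightarrow> P) (at_right t)" "\<And>v. t < v \<Longrightarrow> v < d \<Longrightarrow> f v \<in> K" "t < d" for f P d
  proof (rule Lim_in_closed_set[OF _ _ _ that(1)])
    show "closed K" unfolding K_def by (rule closed_ray_scaleR)
    show "\<forall>\<^sub>F v in at_right t. f v \<in> K" unfolding eventually_at_right_field using that by blast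
  qed simp
  have tJ: "a < t" "t < b" using t by (auto simp: J)
  have 1: "wedge3 (c t) (c v) (c w) \<in> K" if "t < v" "v < w" "w < b" for v w
  proof -
    have "t \<in> J" "v \<in> J" "w \<in> J" using that tJ by (auto simp: J)
    then obtain r where "r > 0" "\<omega> = r *\<^sub>R wedge3 (c t) (c v) (c w)"
      using pos \<open>t < v\<close> \<open>v < w\<close> unfolding positive_basis_def \<omega>_def by blast
    then have "wedge3 (c t) (c v) (c w) = inverse r *\<^sub>R \<omega>" "inverse r \<ge> 0" by auto
    then show ?thesis unfolding K_def by blast
  qed
  \<comment> \<open>Subtracting multiples of other factors does not change a wedge, and positive
    scaling preserves \<open>K\<close>; so points of the arc may be replaced by difference
    quotients.\<close>
  have w_diff: "wedge3 p (q - p) s = wedge3 p q s" for p q s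
    using wedge3_add(2)[of p "q - p" p s] by (simp add: wedge3_same)
  have 2: "wedge3 (c t) (vd J c t) (c w) \<in> K" if w: "t < w" "w < b" for w
  proof (rule lim)
    show "((\<lambda>v. wedge3 (c t) ((c v - c t) /\<^sub>R (v - t)) (c w)) \<longlongrightarrow> wedge3 (c t) (vd J c t) (c w)) (at_right t)"
      unfolding wedge3_conv
      by (intro bounded_bilinear.tendsto[OF bounded_bilinear_wedge12]
          bounded_bilinear.tendsto[OF bounded_bilinear_wedge2] tendsto_const
          tendsto_difference_quotient_at_right dc t)
    show "wedge3 (c t) ((c v - c t) /\<^sub>R (v - t)) (c w) \<in> K" if "t < v" "v < w" for v
      unfolding wedge3_scaleR w_diff using that w by (intro K_scale 1) auto
  qed fact
  have 3: "wedge3 (c t) (vd J c t) (vd J (vd J c) t /\<^sub>R 2) \<in> K"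
  proof (rule lim)
    show "((\<lambda>v. wedge3 (c t) (vd J c t) ((c v - c t - (v - t) *\<^sub>R vd J c t) /\<^sub>R (v - t)\<^sup>2)) \<longlongrightarrow>
        wedge3 (c t) (vd J c t) (vd J (vd J c) t /\<^sub>R 2)) (at_right t)"
      unfolding wedge3_conv
      by (intro bounded_bilinear.tendsto[OF bounded_bilinear_wedge12]
          bounded_bilinear.tendsto[OF bounded_bilinear_wedge2] tendsto_const
          tendsto_second_difference_quotient_at_right[where b = b] dc dc1 t)
        (use tJ in \<open>auto simp: J\<close>)
    show "wedge3 (c t) (vd J c t) ((c v - c t - (v - t) *\<^sub>R vd J c t) /\<^sub>R (v - t)\<^sup>2) \<in> K"
      if v: "t < v" "v < b" for v
    proof -
      have "wedge3 p q (s - p - k *\<^sub>R q) = wedge3 p q s" for p q s k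
        using wedge3_add(3)[of p q "s - p - k *\<^sub>R q" "p + k *\<^sub>R q"]
        by (simp add: wedge3_add wedge3_scaleR wedge3_same)
      then show ?thesis unfolding wedge3_scaleR using v by (simp add: K_scale 2)
    qed
  qed fact
  \<comment> \<open>Scaling by 2 undoes the Taylor factor. Then \<open>nz\<close> excludes
    \<open>r = 0\<close>, so the orientation is not lost in the limit.\<close>
  have "?w \<in> K"
    using K_scale[OF 3, of 2] by (simp add: wedge3_scaleR)
  then obtain r where r: "0 \<le> r" "?w = r *\<^sub>R \<omega>" unfolding K_def by blast
  with nz have "r > 0" by (cases "r = 0") auto
  then show ?thesis
    unfolding r(2) \<theta> \<omega>_def by (simp add: tnorm_scaleR)
qed


section \<open>The conformal quantity in terms of the normalised lift\<close>

lemma bilinear_const_deriv: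
  fixes B :: "'a::real_normed_vector \<Rightarrow> 'b::real_normed_vector \<Rightarrow> real"
  assumes "bounded_bilinear B" "at t within I \<noteq> bot" "t \<in> I" "\<And>s. s \<in> I \<Longrightarrow> B (x s) (y s) = c"
    and "(x has_vector_derivative x') (at t within I)" "(y has_vector_derivative y') (at t within I)"
  shows "B (x t) y' + B x' (y t) = 0"
proof -
  have "((\<lambda>s. B (x s) (y s)) has_vector_derivative 0) (at t within I)"
    using assms(3,4) by (intro has_vector_derivative_transform[OF assms(3) _ has_vector_derivative_const[of c]]) auto
  from vector_derivative_unique_within[OF assms(2) bounded_bilinear.has_vector_derivative[OF assms(1,5,6)] this]
  show ?thesis .
qed

text \<open>The right-hand side is the Gram determinant of \<open>x\<close>, \<open>y\<close>,
  \<open>z\<close>, the square of their determinant.\<close>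

lemma cross3_triple_squared:
  "(z \<bullet> cross3 x y)\<^sup>2 = (x \<bullet> x) * ((y \<bullet> y) * (z \<bullet> z) - (y \<bullet> z)\<^sup>2)
    - (x \<bullet> y) * ((x \<bullet> y) * (z \<bullet> z) - (y \<bullet> z) * (x \<bullet> z))
    + (x \<bullet> z) * ((x \<bullet> y) * (y \<bullet> z) - (y \<bullet> y) * (x \<bullet> z))"
  by (simp add: cross3_def inner_vec_def sum_3) algebra

locale regular_curve =
  fixes I :: "real set" and x :: "real \<Rightarrow> real ^ 3"
  assumes nb: "\<And>t. t \<in> I \<Longrightarrow> at t within I \<noteq> bot"
    and C_x: "\<And>n. C_diff n I x"
    and regular: "\<And>t. t \<in> I \<Longrightarrow> vd I x t \<noteq> 0"
begin

definition speed :: "real \<Rightarrow> real" where "speed t = norm (vd I x t)"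
text \<open>\<open>X1\<close>, \<open>X2\<close>, \<open>X3\<close> are the first three arc-length
  derivatives of the curve, kept as functions of the given parameter; every derivative by this
  parameter carries a factor \<open>speed t\<close>.\<close>

definition X1 where "X1 = tangent I x"
definition X2 where "X2 = darc I x X1"
definition X3 where "X3 = darc I x X2"

lemma speed_pos: "t \<in> I \<Longrightarrow> speed t > 0"
  using regular by (simp add: speed_def)

lemma C_speed: "C_diff n I speed"
proof -
  have "C_diff n I (\<lambda>t. sqrt (vd I x t \<bullet> vd I x t))"
    using regular by (intro C_diff_sqrt C_diff_inner C_diff_vd[OF C_x nb]) auto
  then show ?thesis unfolding speed_def norm_eq_sqrt_inner .
qed

lemma C_inverse_speed: "C_diff n I (\<lambda>t. inverse (speed t))"
  using speed_pos by (intro C_diff_inverse C_speed) fastforce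

lemma darc_eq: "darc I x f t = inverse (speed t) *\<^sub>R vd I f t"
  by (simp add: darc_def speed_def)

lemma C_darc: "C_diff (Suc n) I f \<Longrightarrow> C_diff n I (darc I x f)"
  using C_diff_scaleR[OF C_inverse_speed C_diff_vd[OF _ nb]] by (simp add: darc_eq[abs_def])

lemma deriv_darc:
  assumes "C_diff (Suc n) I f" "t \<in> I"
  shows "(f has_vector_derivative speed t *\<^sub>R darc I x f t) (at t within I)"
  using has_vector_derivative_vd[OF assms] speed_pos[OF assms(2)] by (simp add: darc_eq)

lemma C_X: "C_diff n I X1" "C_diff n I X2" "C_diff n I X3"
  unfolding X3_def X2_def X1_def tangent_def by (intro C_darc C_x)+

lemma deriv_X:
  assumes "t \<in> I"
  shows "(x has_vector_derivative speed t *\<^sub>R X1 t) (at t within I)"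
    "(X1 has_vector_derivative speed t *\<^sub>R X2 t) (at t within I)"
    "(X2 has_vector_derivative speed t *\<^sub>R X3 t) (at t within I)"
proof -
  show "(x has_vector_derivative speed t *\<^sub>R X1 t) (at t within I)"
    unfolding X1_def tangent_def by (rule deriv_darc[OF C_x assms])
  show "(X1 has_vector_derivative speed t *\<^sub>R X2 t) (at t within I)"
    unfolding X2_def by (rule deriv_darc[OF C_X(1) assms])
  show "(X2 has_vector_derivative speed t *\<^sub>R X3 t) (at t within I)"
    unfolding X3_def by (rule deriv_darc[OF C_X(2) assms])
qed

lemma inner_X:
  assumes t: "t \<in> I"
  shows "X1 t \<bullet> X1 t = 1" "X1 t \<bullet> X2 t = 0" "X1 t \<bullet> X3 t = - (X2 t \<bullet> X2 t)"
proof -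
  have 11: "X1 t \<bullet> X1 t = 1" if "t \<in> I" for t
    using regular[OF that] by (simp add: X1_def tangent_def darc_def dot_square_norm power2_eq_square)
  have 12: "X1 t \<bullet> X2 t = 0" if "t \<in> I" for t
    using bilinear_const_deriv[OF bounded_bilinear_inner nb[OF that] that 11 deriv_X(2) deriv_X(2)] that
      speed_pos[OF that]
    by (simp add: inner_commute)
  have "X1 t \<bullet> speed t *\<^sub>R X3 t + speed t *\<^sub>R X2 t \<bullet> X2 t = 0"
    using bilinear_const_deriv[OF bounded_bilinear_inner nb[OF t] t 12 deriv_X(2) deriv_X(3)] t by blast
  then have "speed t * (X1 t \<bullet> X3 t + X2 t \<bullet> X2 t) = 0"
    by (simp add: algebra_simps)
  then show "X1 t \<bullet> X3 t = - (X2 t \<bullet> X2 t)"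
    using speed_pos[OF t] by simp
  show "X1 t \<bullet> X1 t = 1" "X1 t \<bullet> X2 t = 0"
    using 11 12 t by simp_all
qed

lemma curvature_eq: "curvature I x = (\<lambda>t. norm (X2 t))"
  by (simp add: fun_eq_iff curvature_def X2_def X1_def)

text \<open>Where \<kappa> is nonzero, its arc-length derivative is
  \<open>(X2 t \<bullet> X3 t) / k\<close>, and \<open>k\<^sup>2\<close> times the torsion is the
  triple product of \<open>X1\<close>, \<open>X2\<close>, \<open>X3\<close>. By
  \<open>inner_X\<close> the Gram determinant of these vectors simplifies so that the square of the
  first quantity cancels.\<close>

lemma conf_quantity_eq:
  assumes t: "t \<in> I"
  shows "conf_quantity I x t = X3 t \<bullet> X3 t - (X2 t \<bullet> X2 t)\<^sup>2"
proof (cases "curvature I x t = 0")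
  case True
  then show ?thesis
    by (simp add: conf_quantity_def Let_def X3_def X2_def X1_def)
next
  case False
  define k where "k = norm (X2 t)"
  have k: "k > 0" "k * k = X2 t \<bullet> X2 t"
    using False by (simp_all add: k_def curvature_eq dot_square_norm power2_eq_square)
  have dn: "((\<lambda>t. norm (X2 t)) has_real_derivative speed t * (X2 t \<bullet> X3 t) / k) (at t within I)"
  proof -
    have "((\<lambda>t. X2 t \<bullet> X2 t) has_real_derivative 2 * speed t * (X2 t \<bullet> X3 t)) (at t within I)"
      using bounded_bilinear.has_vector_derivative[OF bounded_bilinear_inner deriv_X(3)[OF t] deriv_X(3)[OF t]]
      by (simp add: has_real_derivative_iff_has_vector_derivative inner_commute mult.assoc)
    moreover have "X2 t \<bullet> X2 t > 0" using k by (metis mult_pos_pos)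
    ultimately have "((\<lambda>t. sqrt (X2 t \<bullet> X2 t)) has_real_derivative
        inverse (sqrt (X2 t \<bullet> X2 t)) / 2 * (2 * speed t * (X2 t \<bullet> X3 t))) (at t within I)"
      by (intro DERIV_chain2[OF DERIV_real_sqrt])
    then show ?thesis
      by (simp add: norm_eq_sqrt_inner[symmetric] k_def[symmetric] field_simps)
  qed
  have kappa': "darc I x (curvature I x) t = (X2 t \<bullet> X3 t) / k"
    using vd_eqI[OF dn[unfolded has_real_derivative_iff_has_vector_derivative] nb[OF t]] speed_pos[OF t]
    by (simp add: darc_eq curvature_eq)
  \<comment> \<open>The derivative of \<open>1 / norm (X2 t)\<close>. Its value does not enter the
    torsion, since \<open>X2\<close> is orthogonal to the binormal.\<close>
  define c where "c = - (speed t * (X2 t \<bullet> X3 t) * inverse (X2 t \<bullet> X2 t) / k)"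
  have un: "unit_normal I x = (\<lambda>t. inverse (norm (X2 t)) *\<^sub>R X2 t)"
    by (simp add: fun_eq_iff unit_normal_def curvature_eq X2_def X1_def)
  have "((\<lambda>t. inverse (norm (X2 t))) has_real_derivative c) (at t within I)"
    using DERIV_inverse_fun[OF dn] k by (simp add: c_def k_def[symmetric] power2_eq_square)
  from has_vector_derivative_scaleR[OF this deriv_X(3)[OF t]]
  have "vd I (unit_normal I x) t = inverse k *\<^sub>R speed t *\<^sub>R X3 t + c *\<^sub>R X2 t"
    unfolding un k_def by (intro vd_eqI nb t)
  then have "darc I x (unit_normal I x) t = inverse k *\<^sub>R X3 t + (c / speed t) *\<^sub>R X2 t"
    using speed_pos[OF t] by (simp add: darc_eq scaleR_add_right divide_inverse mult.commute)
  moreover have "binormal I x t = inverse k *\<^sub>R cross3 (X1 t) (X2 t)"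
    unfolding binormal_def un by (simp add: X1_def k_def cross_mult_right)
  ultimately have "torsion I x t = (X3 t \<bullet> cross3 (X1 t) (X2 t)) / k\<^sup>2"
    by (simp add: torsion_def inner_add_left dot_cross_self power2_eq_square divide_inverse)
  then have "k\<^sup>2 * (torsion I x t)\<^sup>2 = (X3 t \<bullet> cross3 (X1 t) (X2 t))\<^sup>2 / k\<^sup>2"
    using k by (simp add: power2_eq_square)
  also have "(X3 t \<bullet> cross3 (X1 t) (X2 t))\<^sup>2 = k\<^sup>2 * (X3 t \<bullet> X3 t) - (X2 t \<bullet> X3 t)\<^sup>2 - k\<^sup>2 * (X2 t \<bullet> X2 t)\<^sup>2"
    unfolding cross3_triple_squared inner_X[OF t] k(2)[symmetric] by (simp add: power2_eq_square)
  finally have "k\<^sup>2 * (torsion I x t)\<^sup>2 =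
    (k\<^sup>2 * (X3 t \<bullet> X3 t) - (X2 t \<bullet> X3 t)\<^sup>2 - k\<^sup>2 * (X2 t \<bullet> X2 t)\<^sup>2) / k\<^sup>2" .
  also have "\<dots> = X3 t \<bullet> X3 t - (X2 t \<bullet> X2 t)\<^sup>2 - ((X2 t \<bullet> X3 t) / k)\<^sup>2"
    using k(1) by (simp add: diff_divide_distrib power_divide)
  finally show ?thesis
    using False by (simp add: conf_quantity_def kappa'[unfolded curvature_eq] curvature_eq k_def[symmetric])
qed

lemma conf_quantity_nonneg:
  assumes "t \<in> I"
  shows "0 \<le> conf_quantity I x t"
proof (cases "curvature I x t = 0")
  case True
  then have "X2 t = 0" by (simp add: curvature_eq)
  then show ?thesis using conf_quantity_eq[OF assms] by simp
next
  case False
  then show ?thesis by (simp add: conf_quantity_def)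
qed

text \<open>\<open>flat_point (x t)\<close> divided by the speed is the lift whose derivative has Lorentz norm 1.\<close>

lemma normalised_lift_conf_quantity:
  assumes k1: "\<And>t. t \<in> I \<Longrightarrow> ((\<lambda>t. inverse (speed t) *\<^sub>R flat_point (x t)) has_vector_derivative k1 t) (at t within I)"
    and k2: "\<And>t. t \<in> I \<Longrightarrow> (k1 has_vector_derivative k2 t) (at t within I)"
    and k3: "\<And>t. t \<in> I \<Longrightarrow> (k2 has_vector_derivative k3 t) (at t within I)"
    and t: "t \<in> I"
  shows "lform (k3 t) (k3 t) - (lform (k2 t) (k2 t))\<^sup>2 = conf_quantity I x t * speed t ^ 4"
proof -
  define w where "w t = inverse (speed t)" for t
  define w1 where "w1 = vd I w"
  define w2 where "w2 = vd I w1"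
  define w3 where "w3 = vd I w2"
  define v1 where "v1 = vd I speed"
  have C_w: "C_diff n I w" for n using C_inverse_speed by (simp add: w_def[abs_def])
  have C_w1: "C_diff n I w1" for n unfolding w1_def by (rule C_diff_vd[OF C_w nb])
  have C_w2: "C_diff n I w2" for n unfolding w2_def by (rule C_diff_vd[OF C_w1 nb])
  \<comment> \<open>The flat lift and its arc-length derivatives, simplified by
    \<open>inner_X\<close>: the 1 in \<open>N2\<close> is \<open>X1 t \<bullet> X1 t\<close>, and in
    \<open>N3\<close> the term \<open>X1 t \<bullet> X2 t\<close> has vanished.\<close>
  define N where "N t = flat_point (x t)" for t
  define N1 where "N1 t = vert (x t \<bullet> X1 t / 2) (X1 t)" for t
  define N2 where "N2 t = vert ((1 + x t \<bullet> X2 t) / 2) (X2 t)" for t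
  define N3 where "N3 t = vert (x t \<bullet> X3 t / 2) (X3 t)" for t
  have vert_scale: "c *\<^sub>R vert p u = vert (c * p) (c *\<^sub>R u)" for c p u
    by (simp add: vert_def vec_eq_iff)
  have dv: "(speed has_real_derivative v1 s) (at s within I)"
    "(w has_real_derivative w1 s) (at s within I)"
    "(w1 has_real_derivative w2 s) (at s within I)"
    "(w2 has_real_derivative w3 s) (at s within I)" if "s \<in> I" for s
    unfolding has_real_derivative_iff_has_vector_derivative v1_def w1_def w2_def w3_def
    using has_vector_derivative_vd[OF C_speed that] has_vector_derivative_vd[OF C_w that]
      has_vector_derivative_vd[OF C_w1 that] has_vector_derivative_vd[OF C_w2 that]
    unfolding w1_def w2_def by blast+
  have wv: "w s * speed s = 1" if "s \<in> I" for s
    using speed_pos[OF that] by (simp add: w_def)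
  have w1v: "w s * v1 s + w1 s * speed s = 0" if "s \<in> I" for s
    using bilinear_const_deriv[OF bounded_bilinear_mult nb[OF that] that wv
        dv(2)[OF that, unfolded has_real_derivative_iff_has_vector_derivative]
        dv(1)[OF that, unfolded has_real_derivative_iff_has_vector_derivative]] that by simp
  have dN: "(N has_vector_derivative speed s *\<^sub>R N1 s) (at s within I)"
    "(N1 has_vector_derivative speed s *\<^sub>R N2 s) (at s within I)"
    "(N2 has_vector_derivative speed s *\<^sub>R N3 s) (at s within I)" if s: "s \<in> I" for s
  proof -
    note d = deriv_X[OF s] and i = inner_X[OF s]
    note di = bounded_bilinear.has_vector_derivative[OF bounded_bilinear_inner]
    show "(N has_vector_derivative speed s *\<^sub>R N1 s) (at s within I)"
      using has_vector_derivative_flat_point[OF d(1)] by (simp add: N_def[abs_def] N1_def vert_scale)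
    show "(N1 has_vector_derivative speed s *\<^sub>R N2 s) (at s within I)"
      using has_vector_derivative_vert[OF has_vector_derivative_divide[OF di[OF d(1,2)]] d(2), of 2] i
      by (simp add: N1_def[abs_def] N2_def vert_scale algebra_simps)
    show "(N2 has_vector_derivative speed s *\<^sub>R N3 s) (at s within I)"
      using has_vector_derivative_vert[OF has_vector_derivative_divide[OF
            has_vector_derivative_add[OF has_vector_derivative_const[of 1] di[OF d(1,3)]]] d(3), of 2] i
      by (simp add: N2_def[abs_def] N3_def vert_scale algebra_simps)
  qed
  note scl = has_vector_derivative_scaleR
  have k1_eq: "k1 s = w1 s *\<^sub>R N s + N1 s" if "s \<in> I" for s
  proof -
    have "((\<lambda>t. w t *\<^sub>R N t) has_vector_derivative k1 s) (at s within I)"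
      using k1[OF that] by (simp add: w_def N_def)
    from vector_derivative_unique_within[OF nb[OF that] this scl[OF dv(2) dN(1)]] that wv[OF that]
    show ?thesis by simp
  qed
  have k2_eq: "k2 s = w2 s *\<^sub>R N s + (w1 s * speed s) *\<^sub>R N1 s + speed s *\<^sub>R N2 s" if s: "s \<in> I" for s
  proof -
    have "((\<lambda>t. w1 t *\<^sub>R N t + N1 t) has_vector_derivative k2 s) (at s within I)"
      using s k1_eq by (intro has_vector_derivative_transform[OF s _ k2]) auto
    from vector_derivative_unique_within[OF nb[OF s] this
        has_vector_derivative_add[OF scl[OF dv(3) dN(1)] dN(2)]] s
    show ?thesis by simp
  qed
  \<comment> \<open>The coefficient of \<open>N1\<close> in \<open>k3\<close>: one
    \<open>w2 t * speed t\<close> comes from the term with \<open>N\<close> in \<open>k2\<close>,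
    the rest from the derivative of \<open>w1 t * speed t\<close>.\<close>
  define \<beta> where "\<beta> = w2 t * speed t + w2 t * speed t + w1 t * v1 t"
  have two: "y * 2 = 2 *\<^sub>R y" for y :: "real ^ 5"
    by (simp only: mult_2_right scaleR_2)
  have k3_eq: "k3 t = w3 t *\<^sub>R N t + \<beta> *\<^sub>R N1 t + (speed t)\<^sup>2 *\<^sub>R N3 t"
  proof -
    have "((\<lambda>t. w2 t *\<^sub>R N t + (w1 t * speed t) *\<^sub>R N1 t + speed t *\<^sub>R N2 t) has_vector_derivative k3 t) (at t within I)"
      using t k2_eq by (intro has_vector_derivative_transform[OF t _ k3]) auto
    from vector_derivative_unique_within[OF nb[OF t] this
        has_vector_derivative_add[OF has_vector_derivative_add[OF scl[OF dv(4) dN(1)]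
          scl[OF DERIV_mult[OF dv(3) dv(1)] dN(2)]] scl[OF dv(1) dN(3)]]] t
    have "k3 t = w3 t *\<^sub>R N t + \<beta> *\<^sub>R N1 t + (speed t)\<^sup>2 *\<^sub>R N3 t + (w1 t * (speed t)\<^sup>2 + v1 t) *\<^sub>R N2 t"
      by (simp add: \<beta>_def algebra_simps power2_eq_square two)
    \<comment> \<open>The coefficient of \<open>N2\<close> is a combination of \<open>w1v\<close>
      and \<open>wv\<close>, hence zero; this is the effect of the normalising factor
      \<open>1 / speed\<close>.\<close>
    moreover have "w1 t * (speed t)\<^sup>2 + v1 t = speed t * (w t * v1 t + w1 t * speed t) + (1 - w t * speed t) * v1 t"
      by (simp add: algebra_simps power2_eq_square)
    ultimately show ?thesis using w1v[OF t] wv[OF t] by simp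
  qed
  note i = inner_X[OF t]
  have pair: "lform (N t) (N t) = 0" "lform (N t) (N1 t) = 0" "lform (N t) (N2 t) = -1" "lform (N t) (N3 t) = 0"
    "lform (N1 t) (N1 t) = 1" "lform (N1 t) (N2 t) = 0" "lform (N1 t) (N3 t) = - (X2 t \<bullet> X2 t)"
    "lform (N2 t) (N2 t) = X2 t \<bullet> X2 t" "lform (N3 t) (N3 t) = X3 t \<bullet> X3 t"
    using i by (simp_all add: N_def N1_def N2_def N3_def lform_flat lform_flat_vert lform_vert add_divide_distrib)
  note pair' = pair(2-4,6,7)[THEN trans[OF lform_commute]]
  define k where "k = X2 t \<bullet> X2 t"
  have a3: "lform (k3 t) (k3 t) = \<beta>\<^sup>2 + speed t ^ 4 * (X3 t \<bullet> X3 t) - 2 * \<beta> * (speed t)\<^sup>2 * k"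
    unfolding k3_eq by (simp add: lform_add lform_scaleR pair pair' k_def power2_eq_square power4_eq_xxxx algebra_simps)
  have a2: "lform (k2 t) (k2 t) = (speed t)\<^sup>2 * k - \<beta>"
  proof -
    have "lform (k2 t) (k2 t) = (w1 t * speed t)\<^sup>2 + (speed t)\<^sup>2 * k - 2 * (w2 t * speed t)"
      unfolding k2_eq[OF t] by (simp add: lform_add lform_scaleR pair pair' k_def power2_eq_square algebra_simps)
    \<comment> \<open>With this relation the terms with derivatives of the speed combine to the same
      \<beta> as in \<open>k3\<close>.\<close>
    moreover have "(w1 t * speed t)\<^sup>2 = - (w1 t * v1 t)"
    proof -
      have "(w1 t * speed t)\<^sup>2 + w1 t * v1 t = w1 t * (speed t * (w t * v1 t + w1 t * speed t) + (1 - w t * speed t) * v1 t)"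
        by (simp add: algebra_simps power2_eq_square)
      then show ?thesis using w1v[OF t] wv[OF t] by simp
    qed
    ultimately show ?thesis by (simp add: \<beta>_def)
  qed
  \<comment> \<open>\<beta> cancels: its terms in \<open>a3\<close> are exactly those in the square
    of \<open>a2\<close>.\<close>
  show ?thesis
    unfolding a2 a3 conf_quantity_eq[OF t] k_def by (simp add: power2_eq_square power4_eq_xxxx algebra_simps)
qed

end


section \<open>Normalised lifts\<close>

text \<open>Starting from \<open>null\<close> and \<open>unit\<close>, each relation is the
  derivative of an earlier one, simplified by those already known.\<close>

lemma normalised_lift_relations:
  assumes nb: "\<And>t. t \<in> I \<Longrightarrow> at t within I \<noteq> bot"
    and d: "\<And>t. t \<in> I \<Longrightarrow> (n has_vector_derivative n1 t) (at t within I)"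
    "\<And>t. t \<in> I \<Longrightarrow> (n1 has_vector_derivative n2 t) (at t within I)"
    "\<And>t. t \<in> I \<Longrightarrow> (n2 has_vector_derivative n3 t) (at t within I)"
    "\<And>t. t \<in> I \<Longrightarrow> (n3 has_vector_derivative n4 t) (at t within I)"
    and null: "\<And>t. t \<in> I \<Longrightarrow> lform (n t) (n t) = 0"
    and unit: "\<And>t. t \<in> I \<Longrightarrow> lform (n1 t) (n1 t) = 1"
    and t: "t \<in> I"
  shows "lform (n t) (n1 t) = 0" "lform (n t) (n2 t) = -1" "lform (n1 t) (n2 t) = 0"
    "lform (n t) (n3 t) = 0" "lform (n1 t) (n3 t) = - lform (n2 t) (n2 t)"
    "lform (n t) (n4 t) = lform (n2 t) (n2 t)"
proof -
  note bc = bilinear_const_deriv[OF bounded_bilinear_lform nb]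
  have 01: "lform (n t) (n1 t) = 0" if "t \<in> I" for t
    using bc[OF that that null d(1)[OF that] d(1)[OF that]] lform_commute[of "n t" "n1 t"] by auto
  have 02: "lform (n t) (n2 t) = -1" if "t \<in> I" for t
    using bc[OF that that 01 d(1)[OF that] d(2)[OF that]] unit[OF that] by auto
  have 12: "lform (n1 t) (n2 t) = 0" if "t \<in> I" for t
    using bc[OF that that unit d(2)[OF that] d(2)[OF that]] lform_commute[of "n1 t" "n2 t"] by auto
  have 03: "lform (n t) (n3 t) = 0" if "t \<in> I" for t
    using bc[OF that that 02 d(1)[OF that] d(3)[OF that]] 12[OF that] by auto
  have 13: "lform (n1 t) (n3 t) = - lform (n2 t) (n2 t)" if "t \<in> I" for t
    using bc[OF that that 12 d(2)[OF that] d(3)[OF that]] by auto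
  have 04: "lform (n t) (n4 t) = lform (n2 t) (n2 t)" if "t \<in> I" for t
    using bc[OF that that 03 d(1)[OF that] d(4)[OF that]] 13[OF that] by auto
  show "lform (n t) (n1 t) = 0" "lform (n t) (n2 t) = -1" "lform (n1 t) (n2 t) = 0"
    "lform (n t) (n3 t) = 0" "lform (n1 t) (n3 t) = - lform (n2 t) (n2 t)"
    "lform (n t) (n4 t) = lform (n2 t) (n2 t)"
    using 01 02 12 03 13 04 t by blast+
qed

text \<open>The trivectors are \<gamma> and its first two derivatives, and
  \<open>tform_wedge3\<close> reduces the claims to Gram determinants. In the last one the two
  squares give \<open>lform n3 n3\<close> and \<open>(lform n2 n2)\<^sup>2\<close>, the mixed terms
  together \<open>- 2 * (lform n2 n2)\<^sup>2\<close>; products such as \<open>lform n2 n3\<close>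
  and \<open>lform n4 n4\<close> drop out.\<close>

lemma tform_normalised_lift:
  assumes "lform n n = 0" "lform n1 n1 = 1" "lform n n1 = 0" "lform n n2 = -1" "lform n1 n2 = 0"
    "lform n n3 = 0" "lform n1 n3 = - lform n2 n2" "lform n n4 = lform n2 n2"
  shows "tform (wedge3 n n1 n2) (wedge3 n n1 n2) = 1"
    and "tform (wedge3 n n1 n3) (wedge3 n n1 n3) = 0"
    and "tform (wedge3 n n2 n3 + wedge3 n n1 n4) (wedge3 n n2 n3 + wedge3 n n1 n4)
      = lform n3 n3 - (lform n2 n2)\<^sup>2"
proof -
  note a = assms assms(3-8)[THEN trans[OF lform_commute]]
  show "tform (wedge3 n n1 n2) (wedge3 n n1 n2) = 1"
    by (simp add: tform_wedge3 det_3 a)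
  show "tform (wedge3 n n1 n3) (wedge3 n n1 n3) = 0"
    by (simp add: tform_wedge3 det_3 a)
  show "tform (wedge3 n n2 n3 + wedge3 n n1 n4) (wedge3 n n2 n3 + wedge3 n n1 n4)
      = lform n3 n3 - (lform n2 n2)\<^sup>2"
    by (simp add: tform_add tform_wedge3 det_3 a power2_eq_square lform_commute[of n3 n2] lform_commute[of n4 n2]
        lform_commute[of n4 n3] lform_commute[of n4 n1])
qed

text \<open>Each model lies in an affine hyperplane, which puts one linear condition on
  \<open>m'\<close>. In \<open>S3\<close> it makes the form positive definite on tangents; in
  \<open>E3\<close> it leaves one null direction, which orthogonality to \<open>m t\<close>
  excludes.\<close>

lemma null_curve_in_model:
  assumes M: "M = S3 \<or> M = E3" and m: "m ` I \<subseteq> M" and t: "t \<in> I"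
    and nb: "at t within I \<noteq> bot" and d: "(m has_vector_derivative m') (at t within I)" and nz: "m' \<noteq> 0"
  shows "lform (m t) (m t) = 0" "lform (m t) m' = 0" "0 < lform m' m'"
proof -
  have null: "lform (m s) (m s) = 0" if "s \<in> I" for s
    using m that M by (auto simp: S3_def light_cone_def E3_def lform_flat image_subset_iff)
  then show "lform (m t) (m t) = 0" using t by blast
  show orth: "lform (m t) m' = 0"
    using bilinear_const_deriv[OF bounded_bilinear_lform nb t null d d] lform_commute[of "m t" m'] by auto
  have lin: "L m' = 0" if "bounded_linear L" "\<And>s. s \<in> I \<Longrightarrow> L (m s) = c" for L :: "real ^ 5 \<Rightarrow> real" and c
  proof -
    have "((\<lambda>s. L (m s)) has_vector_derivative 0) (at t within I)"
      using that(2) t by (intro has_vector_derivative_transform[OF t _ has_vector_derivative_const[of c]]) auto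
    from vector_derivative_unique_within[OF nb bounded_linear.has_vector_derivative[OF that(1) d] this]
    show ?thesis .
  qed
  have zero: "m' = 0" if "m' $ 0 = 0" "m' $ 1 = 0" "m' $ 2 = 0" "m' $ 3 = 0" "m' $ 4 = 0"
    using that UNIV_5 by (auto simp: vec_eq_iff) (metis UNIV_I UNIV_5 insertE empty_iff)
  show "0 < lform m' m'"
  proof (rule ccontr)
    assume neg: "\<not> 0 < lform m' m'"
    show False
    proof (cases "M = S3")
      case True
      have "m' $ 0 = 0"
        using m True by (intro lin[OF bounded_linear_vec_nth, of 0 1]) (auto simp: S3_def image_subset_iff)
      moreover from this neg have "m' $ 1 * m' $ 1 + m' $ 2 * m' $ 2 + m' $ 3 * m' $ 3 + m' $ 4 * m' $ 4 \<le> 0"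
        by (simp add: lform_expand)
      ultimately show False
        using nz zero by (smt (verit, best) mult_eq_0_iff zero_le_square)
    next
      case False
      then have E: "\<And>s. s \<in> I \<Longrightarrow> m s $ 0 - m s $ 1 = 2"
        using m M by (auto simp: E3_def flat_point_def image_subset_iff)
      have "m' $ 0 - m' $ 1 = 0"
        using E by (intro lin[OF bounded_linear_sub[OF bounded_linear_vec_nth bounded_linear_vec_nth], of 0 1 2])
      then have 01: "m' $ 0 = m' $ 1" by simp
      with neg have "m' $ 2 * m' $ 2 + m' $ 3 * m' $ 3 + m' $ 4 * m' $ 4 \<le> 0"
        by (simp add: lform_expand)
      then have 234: "m' $ 2 = 0" "m' $ 3 = 0" "m' $ 4 = 0"
        by (smt (verit, best) mult_eq_0_iff zero_le_square)+
      \<comment> \<open>For such \<open>m'\<close> this product is \<open>- lform (m t) m'\<close>,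
        and its second factor is 2.\<close>
      have "m' $ 1 * (m t $ 0 - m t $ 1) = 0"
        using orth by (auto simp: lform_expand 01 234 algebra_simps)
      then have "m' $ 1 = 0" using E[OF t] by simp
      then show False using zero 01 234 nz by simp
    qed
  qed
qed

text \<open>Both cases of \<open>euclidean_image\<close> become one: a linear Lorentz isometry
  \<open>A\<close> and a positive factor \<open>r\<close>. In \<open>S3\<close> positivity holds
  because the zeroth coordinates of \<open>A (m t)\<close> and \<open>flat_point (x t)\<close> are
  both positive.\<close>

lemma euclidean_image_lift:
  assumes "euclidean_image I m x"
  obtains A r where "bounded_linear A" "\<And>u v. lform (A u) (A v) = lform u v"
    "\<And>t. t \<in> I \<Longrightarrow> 0 < r t" "\<And>t. t \<in> I \<Longrightarrow> A (m t) = r t *\<^sub>R flat_point (x t)"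
proof (cases "\<forall>t\<in>I. m t = flat_point (x t)")
  case True
  then show ?thesis by (intro that[of "\<lambda>u. u" "\<lambda>t. 1"]) (auto simp: bounded_linear_ident)
next
  case False
  then obtain A where m: "m ` I \<subseteq> S3" and A: "orthogonal_transformation A" "A (axis 0 1) = axis 0 1"
    and "\<forall>t\<in>I. \<exists>r. A (m t) = r *\<^sub>R flat_point (x t)"
    using assms unfolding euclidean_image_def by blast
  then obtain r where r: "\<And>t. t \<in> I \<Longrightarrow> A (m t) = r t *\<^sub>R flat_point (x t)" by metis
  have "0 < r t" if "t \<in> I" for t
  proof -
    have "1 = A (m t) $ 0"
      using m that lform_orthogonal_transformation(2)[OF A] by (auto simp: S3_def image_subset_iff)
    also have "\<dots> = r t * (1 + x t \<bullet> x t / 4)"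
      using r[OF that] by (simp add: flat_point_def)
    finally show ?thesis
      using inner_ge_zero[of "x t"] by (smt (verit) divide_nonneg_pos mult_nonpos_nonneg)
  qed
  moreover have "bounded_linear A"
    using A(1) orthogonal_transformation_linear linear_conv_bounded_linear by blast
  ultimately show ?thesis using that lform_orthogonal_transformation(1)[OF A] r by blast
qed

text \<open>A flat point is lightlike and orthogonal to the tangents of \<open>E3\<close>, so
  scaling the lift by \<open>r\<close> multiplies the Lorentz norm of its derivative by
  \<open>r\<close>, whatever the derivative of \<open>r\<close>. Normalised lifts therefore
  agree.\<close>

lemma regular_curve_euclidean_image:
  assumes nb: "\<And>t. t \<in> I \<Longrightarrow> at t within I \<noteq> bot"
    and C_m: "\<And>k. C_diff k I m"
    and A: "bounded_linear A" "\<And>u v. lform (A u) (A v) = lform u v"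
    and r: "\<And>t. t \<in> I \<Longrightarrow> 0 < r t" "\<And>t. t \<in> I \<Longrightarrow> A (m t) = r t *\<^sub>R flat_point (x t)"
    and g: "\<And>t. t \<in> I \<Longrightarrow> 0 < lform (vd I m t) (vd I m t)"
  shows "regular_curve I x"
    and "\<And>t. t \<in> I \<Longrightarrow> inverse (sqrt (lform (vd I m t) (vd I m t))) *\<^sub>R A (m t)
      = inverse (norm (vd I x t)) *\<^sub>R flat_point (x t)"
proof -
  \<comment> \<open>On \<open>r *\<^sub>R flat_point y\<close> the linear maps \<open>L\<close> and
    \<open>P\<close> read off \<open>r\<close> and \<open>r *\<^sub>R y\<close>; thus
    \<open>r\<close> and \<open>x\<close> inherit smoothness from \<open>m\<close>.\<close>
  define L :: "real ^ 5 \<Rightarrow> real" where "L u = (u $ 0 - u $ 1) / 2" for u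
  define P :: "real ^ 5 \<Rightarrow> real ^ 3" where "P u = (\<chi> i. if i = 1 then u $ 2 else if i = 2 then u $ 3 else u $ 4)" for u
  have "linear L" "linear P"
    by (auto intro!: linearI simp: L_def P_def vec_eq_iff field_simps)
  then have blin: "bounded_linear L" "bounded_linear P"
    by (simp_all add: linear_conv_bounded_linear)
  have L_flat: "L (flat_point y) = 1" for y
    by (simp add: L_def flat_point_def)
  have P_flat: "P (flat_point y) = y" for y
    by (auto simp: P_def flat_point_def vec_eq_iff forall_3)
  have r_eq: "L (A (m t)) = r t" if "t \<in> I" for t
    using bounded_linear.linear[OF blin(1)] L_flat by (simp add: r(2)[OF that] linear_scale)
  have x_eq: "inverse (r t) *\<^sub>R P (A (m t)) = x t" if "t \<in> I" for t
    using bounded_linear.linear[OF blin(2)] P_flat r(1)[OF that] by (simp add: r(2)[OF that] linear_scale)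
  have C_Am: "C_diff k I (\<lambda>t. A (m t))" for k
    by (rule C_diff_bounded_linear[OF A(1) C_m])
  have C_r: "C_diff k I r" for k
    by (rule iffD1[OF C_diff_cong C_diff_bounded_linear[OF blin(1) C_Am]]) (rule r_eq)
  have C_x: "C_diff k I x" for k
  proof -
    have "C_diff k I (\<lambda>t. inverse (r t) *\<^sub>R P (A (m t)))"
      using r(1) by (intro C_diff_scaleR C_diff_inverse C_r C_diff_bounded_linear[OF blin(2)] C_Am) fastforce
    then show ?thesis by (rule iffD1[OF C_diff_cong, rotated]) (rule x_eq)
  qed
  have metric: "lform (vd I m t) (vd I m t) = (r t)\<^sup>2 * (vd I x t \<bullet> vd I x t)" if t: "t \<in> I" for t
  proof -
    have dAm: "((\<lambda>t. A (m t)) has_vector_derivative A (vd I m t)) (at t within I)"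
      by (intro bounded_linear.has_vector_derivative[OF A(1)] has_vector_derivative_vd[OF C_m t])
    have dr: "(r has_real_derivative vd I r t) (at t within I)"
      unfolding has_real_derivative_iff_has_vector_derivative by (rule has_vector_derivative_vd[OF C_r t])
    have "((\<lambda>t. r t *\<^sub>R flat_point (x t)) has_vector_derivative A (vd I m t)) (at t within I)"
      using t r(2) by (intro has_vector_derivative_transform[OF t _ dAm]) auto
    from vector_derivative_unique_within[OF nb[OF t] this
        has_vector_derivative_scaleR[OF dr has_vector_derivative_flat_point[OF has_vector_derivative_vd[OF C_x t]]]]
    have "A (vd I m t) = r t *\<^sub>R vert (x t \<bullet> vd I x t / 2) (vd I x t) + vd I r t *\<^sub>R flat_point (x t)" .
    then have "lform (A (vd I m t)) (A (vd I m t)) = (r t)\<^sup>2 * (vd I x t \<bullet> vd I x t)"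
      by (simp add: lform_add lform_scaleR lform_vert lform_flat lform_flat_vert
          lform_commute[of "vert _ _" "flat_point _"] power2_eq_square)
    then show ?thesis by (simp add: A(2))
  qed
  show "regular_curve I x"
  proof
    show "vd I x t \<noteq> 0" if "t \<in> I" for t
      using metric[OF that] g[OF that] by auto
  qed (use nb C_x in auto)
  show "inverse (sqrt (lform (vd I m t) (vd I m t))) *\<^sub>R A (m t) = inverse (norm (vd I x t)) *\<^sub>R flat_point (x t)"
    if "t \<in> I" for t
  proof -
    have "sqrt (lform (vd I m t) (vd I m t)) = r t * norm (vd I x t)"
      using r(1)[OF that] by (simp add: metric[OF that] real_sqrt_mult norm_eq_sqrt_inner)
    then show ?thesis using r(1)[OF that] by (simp add: r(2)[OF that])
  qed
qed

section \<open>The limit of the chord sums\<close>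

theorem corollary7p4:
  fixes M :: "(real ^ 5) set" and m :: "real \<Rightarrow> real ^ 5" and T :: real
    and \<gamma> :: "real \<Rightarrow> trivector" and \<rho> :: "real \<Rightarrow> real" and t :: real
  assumes model: "M = S3 \<or> M = E3"
    and T: "0 < T"
    and curve: "m ` {0..T} \<subseteq> M" "smooth_on {0..T} m" "regular_on {0..T} m"
    and osculating: "\<And>u. u \<in> {0..T} \<Longrightarrow> osculating_circle M {0..T} m u (\<gamma> u)"
    and parameter: "conformal_arclength {0..T} m \<rho>"
    and t: "t \<in> {0..T}"
  shows "\<exists>L. ((\<lambda>ts. \<Sum>i<length ts - 1. sqrt (tnorm (\<gamma> (ts ! Suc i) - \<gamma> (ts ! i)))) \<longlongrightarrow> L)
               (mesh_to_0 0 t)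
           \<and> \<rho> t - \<rho> 0 = root 4 12 * L"
proof -
  define I where "I = {0..T}"
  have nb: "at s within I \<noteq> bot" if "s \<in> I" for s
    using that T at_within_Icc_neq_bot unfolding I_def by blast
  have C_m: "C_diff k I m" for k
    using curve(2) unfolding I_def by (rule smooth_on_imp_C_diff)
  define m1 where "m1 = vd I m"
  define m2 where "m2 = vd I m1"
  have C_m1: "C_diff k I m1" for k unfolding m1_def by (rule C_diff_vd[OF C_m nb])
  have dm: "(m has_vector_derivative m1 s) (at s within I)" "(m1 has_vector_derivative m2 s) (at s within I)"
    if "s \<in> I" for s
    using has_vector_derivative_vd[OF C_m that] has_vector_derivative_vd[OF C_m1 that]
    unfolding m1_def m2_def by blast+
  have "m1 s \<noteq> 0" if "s \<in> I" for s
    using curve(3) that unfolding regular_on_def I_def m1_def by blast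
  then have m: "lform (m s) (m s) = 0" "lform (m s) (m1 s) = 0" "0 < lform (m1 s) (m1 s)" if "s \<in> I" for s
    using null_curve_in_model[OF model curve(1)[folded I_def] that nb[OF that] dm(1)[OF that]] that by blast+
  \<comment> \<open>The factor that gives \<open>f s *\<^sub>R m s\<close> a derivative of Lorentz
    norm 1: the derivative of \<open>f\<close> contributes only a multiple of \<open>m s\<close>,
    which is null and orthogonal to \<open>m1 s\<close>.\<close>
  define f where "f s = inverse (sqrt (lform (m1 s) (m1 s)))" for s
  have f_pos: "f s > 0" and f_unit: "f s * f s * lform (m1 s) (m1 s) = 1" if "s \<in> I" for s
    using m(3)[OF that] by (simp_all add: f_def flip: inverse_mult_distrib)
  have C_f: "C_diff k I f" for k
    unfolding f_def using m(3)
    by (intro C_diff_inverse C_diff_sqrt C_diff_bounded_bilinear[OF bounded_bilinear_lform] C_m1) fastforce+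
  define n where "n s = f s *\<^sub>R m s" for s
  define n1 where "n1 = vd I n"
  define n2 where "n2 = vd I n1"
  define n3 where "n3 = vd I n2"
  define n4 where "n4 = vd I n3"
  have C_n: "C_diff k I n" for k unfolding n_def by (intro C_diff_scaleR C_f C_m)
  have C_n1: "C_diff k I n1" for k unfolding n1_def by (rule C_diff_vd[OF C_n nb])
  have C_n2: "C_diff k I n2" for k unfolding n2_def by (rule C_diff_vd[OF C_n1 nb])
  have C_n3: "C_diff k I n3" for k unfolding n3_def by (rule C_diff_vd[OF C_n2 nb])
  have C_n4: "C_diff k I n4" for k unfolding n4_def by (rule C_diff_vd[OF C_n3 nb])
  have dn: "(n has_vector_derivative n1 s) (at s within I)" "(n1 has_vector_derivative n2 s) (at s within I)"
    "(n2 has_vector_derivative n3 s) (at s within I)" "(n3 has_vector_derivative n4 s) (at s within I)"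
    if "s \<in> I" for s
    unfolding n1_def n2_def n3_def n4_def
    using has_vector_derivative_vd[OF C_n that] has_vector_derivative_vd[OF C_n1 that]
      has_vector_derivative_vd[OF C_n2 that] has_vector_derivative_vd[OF C_n3 that]
    unfolding n1_def n2_def n3_def by blast+
  define f1 where "f1 = vd I f"
  define f2 where "f2 = vd I f1"
  have C_f1: "C_diff k I f1" for k unfolding f1_def by (rule C_diff_vd[OF C_f nb])
  have df: "(f has_real_derivative f1 s) (at s within I)" "(f1 has_real_derivative f2 s) (at s within I)"
    if "s \<in> I" for s
    using has_vector_derivative_vd[OF C_f that] has_vector_derivative_vd[OF C_f1 that]
    unfolding f1_def f2_def has_real_derivative_iff_has_vector_derivative by blast+
  have n1_eq: "n1 s = f s *\<^sub>R m1 s + f1 s *\<^sub>R m s" if "s \<in> I" for s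
    unfolding n1_def n_def by (intro vd_eqI nb that has_vector_derivative_scaleR df dm)
  have n2_eq: "n2 s = (f s *\<^sub>R m2 s + f1 s *\<^sub>R m1 s) + (f1 s *\<^sub>R m1 s + f2 s *\<^sub>R m s)" if s: "s \<in> I" for s
  proof -
    have "((\<lambda>s. f s *\<^sub>R m1 s + f1 s *\<^sub>R m s) has_vector_derivative n2 s) (at s within I)"
      using s n1_eq by (intro has_vector_derivative_transform[OF s _ dn(2)]) auto
    moreover have "((\<lambda>s. f s *\<^sub>R m1 s + f1 s *\<^sub>R m s) has_vector_derivative
        (f s *\<^sub>R m2 s + f1 s *\<^sub>R m1 s) + (f1 s *\<^sub>R m1 s + f2 s *\<^sub>R m s)) (at s within I)"
      by (intro has_vector_derivative_add has_vector_derivative_scaleR df dm s)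
    ultimately show ?thesis using vector_derivative_unique_within[OF nb[OF s]] by blast
  qed
  have n_null: "lform (n s) (n s) = 0" and n1_unit: "lform (n1 s) (n1 s) = 1" if "s \<in> I" for s
    using m[OF that] f_unit[OF that] lform_commute[of "m1 s" "m s"]
    by (simp_all add: n_def n1_eq[OF that] lform_add lform_scaleR mult.assoc)
  note rel = normalised_lift_relations[OF nb dn n_null n1_unit]
  note forms = tform_normalised_lift[OF n_null n1_unit rel]
  define \<Gamma> where "\<Gamma> s = wedge3 (n s) (n1 s) (n2 s)" for s
  define \<Gamma>1 where "\<Gamma>1 s = wedge3 (n s) (n1 s) (n3 s)" for s
  define \<Gamma>2 where "\<Gamma>2 s = wedge3 (n s) (n2 s) (n3 s) + wedge3 (n s) (n1 s) (n4 s)" for s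
  have \<gamma>_eq: "\<gamma> s = \<Gamma> s" if s: "s \<in> I" for s
  proof -
    let ?w = "wedge3 (m s) (m1 s) (m2 s)"
    \<comment> \<open>The jet of \<open>n\<close> arises from that of \<open>m\<close> by a
      triangular matrix with diagonal entries \<open>f s\<close>. As \<open>f s\<close> is positive,
      the orientation is kept, and \<open>tnorm (\<Gamma> s) = 1\<close> fixes the
      normalisation.\<close>
    have \<Gamma>: "\<Gamma> s = (f s) ^ 3 *\<^sub>R ?w"
      unfolding \<Gamma>_def n_def n1_eq[OF s] n2_eq[OF s] wedge3_add wedge3_scaleR wedge3_same
      by (simp add: power3_eq_cube mult_ac)
    have "tform (\<Gamma> s) (\<Gamma> s) = 1" unfolding \<Gamma>_def using s by (intro forms)
    then have one: "tnorm (\<Gamma> s) = 1" and "\<Gamma> s \<noteq> 0" by (auto simp: tnorm_def tform_def)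
    then have "?w \<noteq> 0" using \<Gamma> by auto
    obtain W J c where circ: "oriented_circle M W J c (\<gamma> s)" "s \<in> J"
      and c: "c s = m s" "vd J c s = m1 s" "vd J (vd J c) s = m2 s"
      using osculating[of s] s unfolding osculating_circle_def I_def m1_def m2_def by blast
    have "\<gamma> s = ?w /\<^sub>R tnorm ?w"
      using oriented_circle_eq_jet[OF circ] \<open>?w \<noteq> 0\<close> c by simp
    moreover have "f s ^ 3 * tnorm ?w = 1"
      using one f_pos[OF s] by (simp add: \<Gamma> tnorm_scaleR)
    then have "inverse (tnorm ?w) = f s ^ 3"
      by (simp add: inverse_unique mult.commute)
    ultimately show ?thesis by (simp add: \<Gamma>)
  qed
  \<comment> \<open>Leibniz terms with a repeated factor vanish, which leaves one term in
    \<open>\<Gamma>1\<close> and two in \<open>\<Gamma>2\<close>.\<close>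
  have d\<Gamma>: "(\<gamma> has_vector_derivative \<Gamma>1 s) (at s within I)" "(\<Gamma>1 has_vector_derivative \<Gamma>2 s) (at s within I)"
    if s: "s \<in> I" for s
  proof -
    have "(\<Gamma> has_vector_derivative \<Gamma>1 s) (at s within I)"
      unfolding \<Gamma>_def \<Gamma>1_def using has_vector_derivative_wedge3[OF dn(1,2,3)[OF s]] by (simp add: wedge3_same)
    then show "(\<gamma> has_vector_derivative \<Gamma>1 s) (at s within I)"
      by (intro has_vector_derivative_transform[OF s \<gamma>_eq])
    show "(\<Gamma>1 has_vector_derivative \<Gamma>2 s) (at s within I)"
      unfolding \<Gamma>1_def \<Gamma>2_def using has_vector_derivative_wedge3[OF dn(1,2,4)[OF s]] by (simp add: wedge3_same)
  qed
  have C_\<Gamma>2: "C_diff k I \<Gamma>2" for k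
    unfolding \<Gamma>2_def by (intro C_diff_add C_diff_wedge3 C_n C_n1 C_n2 C_n3 C_n4)
  have C_\<Gamma>3: "C_diff k I (vd I \<Gamma>2)" for k by (rule C_diff_vd[OF C_\<Gamma>2 nb])
  have light: "tform (\<Gamma>1 s) (\<Gamma>1 s) = 0" if "s \<in> I" for s
    unfolding \<Gamma>1_def using that by (intro forms)
  define Q where "Q s = lform (n3 s) (n3 s) - (lform (n2 s) (n2 s))\<^sup>2" for s
  have Q: "tform (\<Gamma>2 s) (\<Gamma>2 s) = Q s" if "s \<in> I" for s
    unfolding \<Gamma>2_def Q_def using that by (intro forms)
  have cont_Q: "continuous_on I Q"
    unfolding Q_def
    by (intro continuous_intros bounded_bilinear.continuous_on[OF bounded_bilinear_lform]
        C_diff_continuous_on[OF C_n2[of 0]] C_diff_continuous_on[OF C_n3[of 0]])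
  obtain x where x: "euclidean_image I m x"
    and \<rho>: "\<And>s. s \<in> I \<Longrightarrow> (\<rho> has_real_derivative root 4 (conf_quantity I x s) * norm (vd I x s)) (at s within I)"
    using parameter unfolding conformal_arclength_def I_def by blast
  obtain A r where A: "bounded_linear A" "\<And>u v. lform (A u) (A v) = lform u v"
    and r: "\<And>t. t \<in> I \<Longrightarrow> 0 < r t" "\<And>t. t \<in> I \<Longrightarrow> A (m t) = r t *\<^sub>R flat_point (x t)"
    using euclidean_image_lift[OF x] by blast
  note image = regular_curve_euclidean_image[OF nb C_m A r m(3)[unfolded m1_def]]
  interpret regular_curve I x by (rule image(1))
  \<comment> \<open>The isometry \<open>A\<close> carries \<open>n\<close> to the normalised flat
    lift of \<open>x\<close>; \<open>Q\<close> involves only Lorentz products and can be computed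
    there.\<close>
  have An: "inverse (speed s) *\<^sub>R flat_point (x s) = A (n s)" if "s \<in> I" for s
  proof -
    have "inverse (sqrt (lform (vd I m s) (vd I m s))) *\<^sub>R A (m s) = inverse (norm (vd I x s)) *\<^sub>R flat_point (x s)"
      using that by (intro image(2))
    then show ?thesis
      using bounded_linear.linear[OF A(1)] by (simp add: speed_def n_def f_def m1_def linear_scale)
  qed
  have Q_conf: "Q s = conf_quantity I x s * speed s ^ 4" if s: "s \<in> I" for s
  proof -
    note dA = bounded_linear.has_vector_derivative[OF A(1)]
    have "lform (A (n3 s)) (A (n3 s)) - (lform (A (n2 s)) (A (n2 s)))\<^sup>2 = conf_quantity I x s * speed s ^ 4"
    proof (rule normalised_lift_conf_quantity[OF _ _ _ s])
      show "((\<lambda>t. inverse (speed t) *\<^sub>R flat_point (x t)) has_vector_derivative A (n1 s)) (at s within I)"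
        if "s \<in> I" for s
        by (rule has_vector_derivative_transform[OF that An dA[OF dn(1)[OF that]]])
    qed (intro dA dn; assumption)+
    then show ?thesis by (simp add: Q_def A(2))
  qed
  have Q_nonneg: "0 \<le> Q s" if "s \<in> I" for s
    using conf_quantity_nonneg[OF that] speed_pos[OF that] by (simp add: Q_conf[OF that])
  \<comment> \<open>The factor \<open>speed s ^ 4\<close> in \<open>Q\<close> leaves the fourth root
    as the speed in the definition of \<rho>.\<close>
  have \<rho>': "(\<rho> has_real_derivative root 4 (Q s)) (at s within I)" if "s \<in> I" for s
    using \<rho>[OF that] speed_pos[OF that]
    by (simp add: Q_conf[OF that] real_root_mult real_root_power_cancel speed_def[symmetric])
  \<comment> \<open>The square of the chord's \<open>tnorm\<close>, so that
    \<open>root 4 (d s u)\<close> is the summand of the theorem.\<close>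
  define d where "d s u = \<bar>tform (\<gamma> u - \<gamma> s) (\<gamma> u - \<gamma> s)\<bar>" for s u
  have "((\<lambda>ts. \<Sum>i<length ts - 1. root 4 (d (ts ! i) (ts ! Suc i))) \<longlongrightarrow> (\<rho> t - \<rho> 0) / root 4 12) (mesh_to_0 0 t)"
  proof (rule sum_root_4_tendsto[of t T Q])
    fix e :: real assume "e > 0"
    have "C_diff 0 I (vd I (vd I \<Gamma>2))" by (rule C_diff_vd[OF C_\<Gamma>3 nb])
    then have "\<exists>\<delta>>0. \<forall>s\<in>{0..T}. \<forall>u\<in>{0..T}. s \<le> u \<and> u - s < \<delta> \<longrightarrow>
        \<bar>tform (\<gamma> u - \<gamma> s) (\<gamma> u - \<gamma> s) + tform (\<Gamma>2 s) (\<Gamma>2 s) / 12 * (u - s) ^ 4\<bar> \<le> e * (u - s) ^ 4"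
      using d\<Gamma> light has_vector_derivative_vd[OF C_\<Gamma>2] has_vector_derivative_vd[OF C_\<Gamma>3] \<open>e > 0\<close>
      unfolding I_def
      by (intro lightlike_curve_expansion[OF bounded_bilinear_tform tform_commute T, where g = \<gamma> and ?g1.0 = \<Gamma>1
            and ?g2.0 = \<Gamma>2 and ?g3.0 = "vd {0..T} \<Gamma>2" and ?g4.0 = "vd {0..T} (vd {0..T} \<Gamma>2)"]) simp_all
    then obtain \<delta> where "\<delta> > 0" and \<delta>: "\<forall>s\<in>{0..T}. \<forall>u\<in>{0..T}. s \<le> u \<and> u - s < \<delta> \<longrightarrow>
        \<bar>tform (\<gamma> u - \<gamma> s) (\<gamma> u - \<gamma> s) + tform (\<Gamma>2 s) (\<Gamma>2 s) / 12 * (u - s) ^ 4\<bar> \<le> e * (u - s) ^ 4"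
      by (elim exE conjE) (rule that)
    show "\<exists>\<delta>>0. \<forall>s\<in>{0..T}. \<forall>u\<in>{0..T}. s \<le> u \<and> u - s < \<delta> \<longrightarrow>
        \<bar>d s u - Q s / 12 * (u - s) ^ 4\<bar> \<le> e * (u - s) ^ 4"
    proof (intro exI[of _ \<delta>] conjI ballI impI)
      fix s u assume su: "s \<in> {0..T}" "u \<in> {0..T}" "s \<le> u \<and> u - s < \<delta>"
      \<comment> \<open>The form of the chord is close to the nonpositive
        \<open>- Q s / 12 * (u - s) ^ 4\<close>; taking absolute values reverses the sign without
        enlarging the error.\<close>
      have "\<bar>\<bar>a\<bar> - b\<bar> \<le> c" if "\<bar>a + b\<bar> \<le> c" "0 \<le> b" for a b c :: real
        using that by linarith
      then show "\<bar>d s u - Q s / 12 * (u - s) ^ 4\<bar> \<le> e * (u - s) ^ 4"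
        using \<delta>[rule_format, OF su] Q_nonneg[of s] Q[of s] su by (simp add: d_def I_def)
    qed fact
  qed (use t cont_Q Q_nonneg \<rho>' in \<open>auto simp: I_def d_def\<close>)
  then have "((\<lambda>ts. \<Sum>i<length ts - 1. sqrt (tnorm (\<gamma> (ts ! Suc i) - \<gamma> (ts ! i)))) \<longlongrightarrow> (\<rho> t - \<rho> 0) / root 4 12)
      (mesh_to_0 0 t)"
    by (simp add: d_def root_4_eq_sqrt tnorm_def)
  then show ?thesis
    by (intro exI[of _ "(\<rho> t - \<rho> 0) / root 4 12"]) simp
qed

end
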